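(* Let $G$ be a linear algebraic group over an algebraically closed field $\Bbbk$ and let $G^0$ denote the connected component of the identity. Then $$\delta(G)\le \delta(G/G^0)\,\delta(G^0).$$ In particular, $\delta(G)$ is finite if $\delta(G^0)$ is finite.
   Context: For a linear algebraic group $G$ over $\Bbbk$, a $G$-module is a finite-dimensional rational representation $V$ of $G$ over $\Bbbk$. $\Bbbk[V]\cong S(V^* )$ is the ring of polynomial functions on $V$, with $G$-action $(g\cdot f)(v)=f(g^{-1}v)$ and invariant ring $\Bbbk[V]^G$, graded by degree. $\Bbbk[V]^G_{\le d}$ is the set of invariants of degree at most $d$. For $S\subseteq \Bbbk[V]$, $S_+$ is the set of elements of $S$ with constant term zero. The nullcone $\mathcal{N}_{G,V}\subseteq V$ is the common zero set of $\Bbbk[V]^G_+$. A subset $S\subseteq\Bbbk[V]^G$ is a $\delta$-set if for every $v\in V^G\setminus\mathcal{N}_{G,V}$ there is $f\in S_+$ with $f(v)\neq 0$. Define $\delta(G,V)=\min\{d\ge 0 : \Bbbk[V]^G_{\le d}\text{ is a }\delta\text{-set}\}$ and $\delta(G)=\sup\{\delta(G,V): V\text{ a }G\text{-module}\}\in\mathbb{N}\cup\{\infty\}$ (equal to $\infty$ if unbounded). *)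

theory Defs
  imports
    "HOL-Algebra.Coset"
    "HOL-Analysis.Abstract_Topology_2"
    "HOL-Computational_Algebra.Polynomial"
    "HOL-Library.Extended_Nat"
    "Jordan_Normal_Form.Matrix"
begin

text \<open>
  Throughout, a function on a set is an unrestricted HOL function of which only the values on that
  set matter; all sets of functions below are closed under changing values elsewhere.
\<close>

subsection \<open>Polynomial functions on affine space\<close>

definition exponents :: "nat \<Rightarrow> nat \<Rightarrow> (nat \<Rightarrow> nat) set" where
  "exponents n d = {a. (\<forall>i\<ge>n. a i = 0) \<and> (\<Sum>i<n. a i) \<le> d}"

text \<open>
  Over an infinite field a polynomial is determined by its function, so the following is the space
  of polynomials of total degree at most \<open>d\<close> in \<open>n\<close> variables.
\<close>

definition poly_funs_le :: "nat \<Rightarrow> nat \<Rightarrow> ('k::field vec \<Rightarrow> 'k) set" where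
  "poly_funs_le n d =
     {f. \<exists>c. \<forall>v\<in>carrier_vec n. f v = (\<Sum>a\<in>exponents n d. c a * (\<Prod>i<n. (v $ i) ^ a i))}"

definition poly_funs :: "nat \<Rightarrow> ('k::field vec \<Rightarrow> 'k) set" where
  "poly_funs n = (\<Union>d. poly_funs_le n d)"

subsection \<open>Linear algebraic groups\<close>

record ('g, 'k) alg_group = "'g monoid" +
  coord_ring :: "('g \<Rightarrow> 'k) set"

text \<open>A set with a ring of functions that is isomorphic to a Zariski closed subset of some affine space.\<close>

definition affine_variety :: "'g set \<Rightarrow> ('g \<Rightarrow> 'k::field) set \<Rightarrow> bool" where
  "affine_variety X A \<longleftrightarrow>
     (\<exists>n \<phi> I. I \<subseteq> poly_funs n
        \<and> bij_betw \<phi> X {v \<in> carrier_vec n. \<forall>p\<in>I. p v = 0}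
        \<and> A = {f. \<exists>p\<in>poly_funs n. \<forall>x\<in>X. f x = p (\<phi> x)})"

text \<open>The coordinate ring \<open>A \<otimes> A\<close> of \<open>X \<times> X\<close>.\<close>

definition product_coord_ring :: "'g set \<Rightarrow> ('g \<Rightarrow> 'k::field) set \<Rightarrow> ('g \<times> 'g \<Rightarrow> 'k) set" where
  "product_coord_ring X A =
     {F. \<exists>(m::nat) a b. (\<forall>i<m. a i \<in> A \<and> b i \<in> A)
        \<and> (\<forall>x\<in>X. \<forall>y\<in>X. F (x, y) = (\<Sum>i<m. a i x * b i y))}"

definition linear_algebraic_group :: "('g, 'k::field) alg_group \<Rightarrow> bool" where
  "linear_algebraic_group G \<longleftrightarrow>
     group G
     \<and> affine_variety (carrier G) (coord_ring G)
     \<and> (\<forall>f\<in>coord_ring G.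
          (\<lambda>(x, y). f (x \<otimes>\<^bsub>G\<^esub> y)) \<in> product_coord_ring (carrier G) (coord_ring G))
     \<and> (\<forall>f\<in>coord_ring G. (\<lambda>x. f (inv\<^bsub>G\<^esub> x)) \<in> coord_ring G)"

definition zariski_topology :: "('g, 'k::field) alg_group \<Rightarrow> 'g topology" where
  "zariski_topology G =
     topology (\<lambda>U. \<exists>S\<subseteq>coord_ring G. U = carrier G - {x \<in> carrier G. \<forall>f\<in>S. f x = 0})"

definition identity_component :: "('g, 'k::field) alg_group \<Rightarrow> 'g set" where
  "identity_component G = connected_component_of_set (zariski_topology G) \<one>\<^bsub>G\<^esub>"

definition alg_subgroup :: "('g, 'k::field) alg_group \<Rightarrow> 'g set \<Rightarrow> ('g, 'k) alg_group" where
  "alg_subgroup G H =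
     G\<lparr>carrier := H, coord_ring := {f. \<exists>h\<in>coord_ring G. \<forall>x\<in>H. f x = h x}\<rparr>"

text \<open>
  For a closed normal subgroup \<open>H\<close>, the coordinate ring of \<open>G/H\<close> is the ring of \<open>H\<close>-invariants
  of the coordinate ring of \<open>G\<close>.
\<close>

definition alg_quotient :: "('g, 'k::field) alg_group \<Rightarrow> 'g set \<Rightarrow> ('g set, 'k) alg_group" where
  "alg_quotient G H =
     monoid.extend (G Mod H)
       (alg_group.fields {f. (\<lambda>x. f (H #>\<^bsub>G\<^esub> x)) \<in> coord_ring G})"

subsection \<open>Modules, invariants and the delta number\<close>

text \<open>
  A \<open>G\<close>-module of dimension \<open>n\<close> is given, after a choice of basis, by a matrix representation on
  \<open>carrier_vec n\<close> whose entries are regular functions on \<open>G\<close>.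
\<close>

definition rational_rep :: "('g, 'k::field) alg_group \<Rightarrow> nat \<Rightarrow> ('g \<Rightarrow> 'k mat) \<Rightarrow> bool" where
  "rational_rep G n \<rho> \<longleftrightarrow>
     (\<forall>g\<in>carrier G. \<rho> g \<in> carrier_mat n n)
     \<and> \<rho> \<one>\<^bsub>G\<^esub> = 1\<^sub>m n
     \<and> (\<forall>g\<in>carrier G. \<forall>h\<in>carrier G. \<rho> (g \<otimes>\<^bsub>G\<^esub> h) = \<rho> g * \<rho> h)
     \<and> (\<forall>i<n. \<forall>j<n. (\<lambda>g. \<rho> g $$ (i, j)) \<in> coord_ring G)"

definition fun_action ::
  "('g, 'k::field) alg_group \<Rightarrow> ('g \<Rightarrow> 'k mat) \<Rightarrow> 'g \<Rightarrow> ('k vec \<Rightarrow> 'k) \<Rightarrow> 'k vec \<Rightarrow> 'k" where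
  "fun_action G \<rho> g f = (\<lambda>v. f (\<rho> (inv\<^bsub>G\<^esub> g) *\<^sub>v v))"

definition invariants ::
  "('g, 'k::field) alg_group \<Rightarrow> nat \<Rightarrow> ('g \<Rightarrow> 'k mat) \<Rightarrow> ('k vec \<Rightarrow> 'k) set" where
  "invariants G n \<rho> =
     {f \<in> poly_funs n. \<forall>g\<in>carrier G. \<forall>v\<in>carrier_vec n. fun_action G \<rho> g f v = f v}"

definition invariants_le ::
  "('g, 'k::field) alg_group \<Rightarrow> nat \<Rightarrow> ('g \<Rightarrow> 'k mat) \<Rightarrow> nat \<Rightarrow> ('k vec \<Rightarrow> 'k) set" where
  "invariants_le G n \<rho> d = invariants G n \<rho> \<inter> poly_funs_le n d"

text \<open>The constant term of a polynomial function is its value at the origin.\<close>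

definition zero_const :: "nat \<Rightarrow> ('k::field vec \<Rightarrow> 'k) set \<Rightarrow> ('k vec \<Rightarrow> 'k) set" where
  "zero_const n S = {f \<in> S. f (0\<^sub>v n) = 0}"

definition nullcone ::
  "('g, 'k::field) alg_group \<Rightarrow> nat \<Rightarrow> ('g \<Rightarrow> 'k mat) \<Rightarrow> 'k vec set" where
  "nullcone G n \<rho> = {v \<in> carrier_vec n. \<forall>f\<in>zero_const n (invariants G n \<rho>). f v = 0}"

definition fixed_points ::
  "('g, 'k::field) alg_group \<Rightarrow> nat \<Rightarrow> ('g \<Rightarrow> 'k mat) \<Rightarrow> 'k vec set" where
  "fixed_points G n \<rho> = {v \<in> carrier_vec n. \<forall>g\<in>carrier G. \<rho> g *\<^sub>v v = v}"

definition delta_set ::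
  "('g, 'k::field) alg_group \<Rightarrow> nat \<Rightarrow> ('g \<Rightarrow> 'k mat) \<Rightarrow> ('k vec \<Rightarrow> 'k) set \<Rightarrow> bool" where
  "delta_set G n \<rho> S \<longleftrightarrow>
     S \<subseteq> invariants G n \<rho>
     \<and> (\<forall>v\<in>fixed_points G n \<rho> - nullcone G n \<rho>. \<exists>f\<in>zero_const n S. f v \<noteq> 0)"

text \<open>
  The set of admissible \<open>d\<close> is never empty, by Hilbert's basis theorem, so the infimum
  is a minimum and a natural number.
\<close>

definition delta_rep :: "('g, 'k::field) alg_group \<Rightarrow> nat \<Rightarrow> ('g \<Rightarrow> 'k mat) \<Rightarrow> enat" where
  "delta_rep G n \<rho> = (INF d\<in>{d. delta_set G n \<rho> (invariants_le G n \<rho> d)}. enat d)"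

definition delta :: "('g, 'k::field) alg_group \<Rightarrow> enat" where
  "delta G = (SUP (n, \<rho>)\<in>{(n, \<rho>). rational_rep G n \<rho>}. delta_rep G n \<rho>)"

subsection \<open>The Zariski topology is well defined\<close>

lemma finite_exponents: "finite (exponents n d)"
proof -
  have "a i \<le> d" if "a \<in> exponents n d" for a i
  proof (cases "i < n")
    case True
    then have "a i \<le> (\<Sum>i<n. a i)" by (intro member_le_sum) auto
    then show ?thesis using that by (auto simp: exponents_def)
  qed (use that in \<open>auto simp: exponents_def\<close>)
  then have "exponents n d \<subseteq> {a. \<forall>i. (i \<in> {..<n} \<longrightarrow> a i \<in> {..d}) \<and> (i \<notin> {..<n} \<longrightarrow> a i = 0)}"
    by (auto simp: exponents_def)
  then show ?thesis
    by (rule finite_subset) (intro finite_set_of_finite_funs, auto)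
qed

lemma poly_funs_mult:
  assumes "p \<in> poly_funs n" "q \<in> poly_funs n"
  shows "(\<lambda>v. p v * q v) \<in> poly_funs n"
proof -
  obtain d e c c' where
    c: "\<And>v. v \<in> carrier_vec n \<Longrightarrow> p v = (\<Sum>a\<in>exponents n d. c a * (\<Prod>i<n. (v $ i) ^ a i))" and
    c': "\<And>v. v \<in> carrier_vec n \<Longrightarrow> q v = (\<Sum>a\<in>exponents n e. c' a * (\<Prod>i<n. (v $ i) ^ a i))"
    using assms by (auto simp: poly_funs_def poly_funs_le_def)
  let ?P = "exponents n d \<times> exponents n e"
  let ?s = "\<lambda>(a, b) i. a i + b i :: nat"
  define c'' where "c'' m = (\<Sum>ab\<in>{ab\<in>?P. ?s ab = m}. c (fst ab) * c' (snd ab))" for m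
  have s: "?s ` ?P \<subseteq> exponents n (d + e)"
    by (auto simp: exponents_def sum.distrib intro: add_mono)
  have "p v * q v = (\<Sum>m\<in>exponents n (d + e). c'' m * (\<Prod>i<n. (v $ i) ^ m i))"
    if v: "v \<in> carrier_vec n" for v
  proof -
    let ?m = "\<lambda>a. \<Prod>i<n. (v $ i) ^ a i"
    have "p v * q v = (\<Sum>ab\<in>?P. c (fst ab) * c' (snd ab) * ?m (?s ab))"
      unfolding c[OF v] c'[OF v] sum_product sum.cartesian_product
      by (intro sum.cong) (auto simp: power_add prod.distrib)
    also have "\<dots> = (\<Sum>m\<in>exponents n (d + e). \<Sum>ab\<in>{ab\<in>?P. ?s ab = m}.
        c (fst ab) * c' (snd ab) * ?m (?s ab))"
      by (rule sum.group[symmetric]) (use s in \<open>auto simp: finite_exponents\<close>)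
    also have "\<dots> = (\<Sum>m\<in>exponents n (d + e). c'' m * ?m m)"
      unfolding c''_def sum_distrib_right by (intro sum.cong) auto
    finally show ?thesis .
  qed
  then show ?thesis
    unfolding poly_funs_def poly_funs_le_def by blast
qed

lemma openin_zariski_topology:
  assumes "linear_algebraic_group G"
  shows "openin (zariski_topology G) U \<longleftrightarrow>
    (\<exists>S\<subseteq>coord_ring G. U = carrier G - {x \<in> carrier G. \<forall>f\<in>S. f x = 0})"
proof -
  let ?U = "\<lambda>S. carrier G - {x \<in> carrier G. \<forall>f\<in>S. f x = 0}"
  have mult: "(\<lambda>x. f x * h x) \<in> coord_ring G" if "f \<in> coord_ring G" "h \<in> coord_ring G" for f h
  proof -
    obtain n \<phi> where A: "coord_ring G = {f. \<exists>p\<in>poly_funs n. \<forall>x\<in>carrier G. f x = p (\<phi> x)}"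
      using assms unfolding linear_algebraic_group_def affine_variety_def by blast
    then obtain p q where "p \<in> poly_funs n" "\<forall>x\<in>carrier G. f x = p (\<phi> x)"
      "q \<in> poly_funs n" "\<forall>x\<in>carrier G. h x = q (\<phi> x)"
      using \<open>f \<in> coord_ring G\<close> \<open>h \<in> coord_ring G\<close> by auto
    then show ?thesis
      unfolding A by (auto intro!: bexI[OF _ poly_funs_mult[of p n q]])
  qed
  have "istopology (\<lambda>U. \<exists>S\<subseteq>coord_ring G. U = ?U S)"
    unfolding istopology_def
  proof (intro conjI allI impI)
    fix U V assume "\<exists>S\<subseteq>coord_ring G. U = ?U S" "\<exists>S\<subseteq>coord_ring G. V = ?U S"
    then obtain S T where S: "S \<subseteq> coord_ring G" "U = ?U S" and T: "T \<subseteq> coord_ring G" "V = ?U T"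
      by blast
    let ?ST = "(\<lambda>(f, h) x. f x * h x) ` (S \<times> T)"
    have "?ST \<subseteq> coord_ring G" using S(1) T(1) by (auto intro!: mult)
    moreover have "U \<inter> V = ?U ?ST"
    proof (rule Set.set_eqI)
      fix x
      have "(\<forall>k\<in>?ST. k x = 0) \<longleftrightarrow> (\<forall>f\<in>S. \<forall>h\<in>T. f x * h x = 0)" by auto
      also have "\<dots> \<longleftrightarrow> (\<forall>f\<in>S. f x = 0) \<or> (\<forall>h\<in>T. h x = 0)" by auto
      finally show "x \<in> U \<inter> V \<longleftrightarrow> x \<in> ?U ?ST"
        unfolding S(2) T(2) Diff_iff Int_iff mem_Collect_eq by argo
    qed
    ultimately show "\<exists>S\<subseteq>coord_ring G. U \<inter> V = ?U S" by blast
  next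
    fix \<K> assume "\<forall>K\<in>\<K>. \<exists>S\<subseteq>coord_ring G. K = ?U S"
    then have "\<K> = ?U ` {S. S \<subseteq> coord_ring G \<and> ?U S \<in> \<K>}" (is "_ = ?U ` ?F") by fast
    moreover have "\<Union>(?U ` ?F) = ?U (\<Union>?F)" by auto
    ultimately have "\<Union>\<K> = ?U (\<Union>?F)" by (rule ssubst)
    moreover have "\<Union>?F \<subseteq> coord_ring G" by auto
    ultimately show "\<exists>S\<subseteq>coord_ring G. \<Union>\<K> = ?U S" by blast
  qed
  then show ?thesis
    unfolding zariski_topology_def by (simp add: topology_inverse')
qed

end

theory Submission
  imports Defs
begin

text \<open>
  Write \<open>H\<close> for the identity component. The Zariski topology is Noetherian, so \<open>H\<close> is a normal
  subgroup of finite index. If a \<open>G\<close>-fixed point \<open>v\<close> lies outside the nullcone of \<open>G\<close>, it lies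
  outside that of \<open>H\<close>, and some \<open>H\<close>-invariant \<open>f\<close> of degree at most \<open>\<delta>(H)\<close> without constant term
  has \<open>f(v) \<noteq> 0\<close>. The finitely many translates of \<open>f\<close> form a \<open>G\<close>-equivariant polynomial map to
  a permutation module of \<open>G/H\<close>, which sends \<open>v\<close> to a nonzero fixed point. For a finite group such
  a point is outside the nullcone, so a \<open>G/H\<close>-invariant of degree at most \<open>\<delta>(G/H)\<close> without
  constant term detects it; its pullback has degree at most \<open>\<delta>(G/H) \<delta>(H)\<close>. Finally
  \<open>1 \<le> \<delta>(G/H) \<le> |G/H|\<close>, where the lower bound disposes of the case \<open>\<delta>(H) = \<infinity>\<close>, since
  \<open>0 * \<infinity> = 0\<close>.
\<close>

subsection \<open>Monomials and polynomial functions\<close>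

definition monomial :: "nat \<Rightarrow> (nat \<Rightarrow> nat) \<Rightarrow> 'k::field vec \<Rightarrow> 'k" where
  "monomial n a v = (\<Prod>i<n. (v $ i) ^ a i)"

text \<open>The exponent set \<open>X\<close> is arbitrary, so that one notion expresses both a
  degree bound and a bound on the leading exponent. Each representation is finite even when
  \<open>X\<close> is not.\<close>

definition monomial_span :: "nat \<Rightarrow> (nat \<Rightarrow> nat) set \<Rightarrow> ('k::field vec \<Rightarrow> 'k) set" where
  "monomial_span n X = {f. \<exists>T c. finite T \<and> T \<subseteq> X \<and>
     (\<forall>v\<in>carrier_vec n. f v = (\<Sum>a\<in>T. c a * monomial n a v))}"

lemma monomial_add: "monomial n (\<lambda>i. a i + b i) v = monomial n a v * monomial n b v"
  by (simp add: monomial_def power_add prod.distrib)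

lemma monomial_span_cong:
  assumes "f \<in> monomial_span n X" "\<And>v. v \<in> carrier_vec n \<Longrightarrow> g v = f v"
  shows "g \<in> monomial_span n X"
  using assms unfolding monomial_span_def by simp

lemma monomial_span_mono: "X \<subseteq> Y \<Longrightarrow> monomial_span n X \<subseteq> monomial_span n Y"
  unfolding monomial_span_def by blast

lemma monomial_span_zero: "(\<lambda>v. 0) \<in> monomial_span n X"
  unfolding monomial_span_def by (auto intro!: exI[of _ "{}"])

lemma monomial_span_monomial: "a \<in> X \<Longrightarrow> (\<lambda>v. c * monomial n a v) \<in> monomial_span n X"
  unfolding monomial_span_def by (auto intro!: exI[of _ "{a}"] exI[of _ "\<lambda>_. c"])

lemma monomial_span_add:
  assumes "f \<in> monomial_span n X" "g \<in> monomial_span n X"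
  shows "(\<lambda>v. f v + g v) \<in> monomial_span n X"
proof -
  obtain T c where T: "finite T" "T \<subseteq> X"
    "\<And>v. v \<in> carrier_vec n \<Longrightarrow> f v = (\<Sum>a\<in>T. c a * monomial n a v)"
    using assms(1) unfolding monomial_span_def by blast
  obtain U d where U: "finite U" "U \<subseteq> X"
    "\<And>v. v \<in> carrier_vec n \<Longrightarrow> g v = (\<Sum>a\<in>U. d a * monomial n a v)"
    using assms(2) unfolding monomial_span_def by blast
  have ext: "(\<Sum>a\<in>S. e a * monomial n a v) =
      (\<Sum>a\<in>T \<union> U. (if a \<in> S then e a else 0) * monomial n a v)" if "S \<subseteq> T \<union> U"
    for S e and v :: "'a vec"
    by (rule sum.mono_neutral_cong_left) (use that T U in auto)
  have "f v + g v = (\<Sum>a\<in>T \<union> U.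
      ((if a \<in> T then c a else 0) + (if a \<in> U then d a else 0)) * monomial n a v)"
    if "v \<in> carrier_vec n" for v
    unfolding T(3)[OF that] U(3)[OF that]
    by (subst (1 2) ext) (auto simp: sum.distrib algebra_simps)
  then show ?thesis
    unfolding monomial_span_def using T U
    by (auto intro!: exI[of _ "T \<union> U"]
        exI[of _ "\<lambda>a. (if a \<in> T then c a else 0) + (if a \<in> U then d a else 0)"])
qed

lemma monomial_span_sum:
  assumes "\<And>i. i \<in> S \<Longrightarrow> f i \<in> monomial_span n X"
  shows "(\<lambda>v. \<Sum>i\<in>S. f i v) \<in> monomial_span n X"
  using assms
  by (induction S rule: infinite_finite_induct)
    (auto intro: monomial_span_zero monomial_span_add)

lemma monomial_span_mult:
  assumes "f \<in> monomial_span n X" "g \<in> monomial_span n Y"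
    and "\<And>a b. a \<in> X \<Longrightarrow> b \<in> Y \<Longrightarrow> (\<lambda>i. a i + b i) \<in> Z"
  shows "(\<lambda>v. f v * g v) \<in> monomial_span n Z"
proof -
  obtain T c where T: "finite T" "T \<subseteq> X"
    "\<And>v. v \<in> carrier_vec n \<Longrightarrow> f v = (\<Sum>a\<in>T. c a * monomial n a v)"
    using assms(1) unfolding monomial_span_def by blast
  obtain U d where U: "finite U" "U \<subseteq> Y"
    "\<And>v. v \<in> carrier_vec n \<Longrightarrow> g v = (\<Sum>a\<in>U. d a * monomial n a v)"
    using assms(2) unfolding monomial_span_def by blast
  have "(\<lambda>v. \<Sum>a\<in>T. \<Sum>b\<in>U. (c a * d b) * monomial n (\<lambda>i. a i + b i) v) \<in> monomial_span n Z"
    using T(2) U(2) by (intro monomial_span_sum monomial_span_monomial assms(3)) auto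
  then show ?thesis
    by (rule monomial_span_cong) (simp add: T(3) U(3) sum_product monomial_add mult_ac)
qed

lemma monomial_span_scale:
  assumes "f \<in> monomial_span n X"
  shows "(\<lambda>v. c * f v) \<in> monomial_span n X"
proof -
  have "(\<lambda>v. (c * monomial n (\<lambda>i. 0) v) * f v) \<in> monomial_span n X"
    by (rule monomial_span_mult[OF monomial_span_monomial[of _ "{\<lambda>i. 0}"] assms]) auto
  then show ?thesis
    by (rule monomial_span_cong) (simp add: monomial_def)
qed

text \<open>Padding the coefficients with zeros turns a sum over a finite subset into one over all
  of \<open>exponents n d\<close>, which is finite. The basic degree rules below are then read off
  from the rules for spans.\<close>

lemma poly_funs_le_eq_monomial_span: "poly_funs_le n d = monomial_span n (exponents n d)"
proof (intro equalityI subsetI)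
  fix f :: "'a vec \<Rightarrow> 'a" assume "f \<in> monomial_span n (exponents n d)"
  then obtain T c where T: "finite T" "T \<subseteq> exponents n d"
    "\<And>v. v \<in> carrier_vec n \<Longrightarrow> f v = (\<Sum>a\<in>T. c a * monomial n a v)"
    unfolding monomial_span_def by blast
  have "(\<Sum>a\<in>T. c a * monomial n a v) =
      (\<Sum>a\<in>exponents n d. (if a \<in> T then c a else 0) * monomial n a v)" for v
    by (rule sum.mono_neutral_cong_left) (use T in \<open>auto simp: finite_exponents\<close>)
  then show "f \<in> poly_funs_le n d"
    unfolding poly_funs_le_def monomial_def[symmetric]
    by (auto simp: T(3) intro!: exI[of _ "\<lambda>a. if a \<in> T then c a else 0"])
qed (use finite_exponents in \<open>auto simp: poly_funs_le_def monomial_span_def monomial_def\<close>)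

lemma poly_funs_le_mono: "d \<le> e \<Longrightarrow> poly_funs_le n d \<subseteq> poly_funs_le n e"
  unfolding poly_funs_le_eq_monomial_span
  by (rule monomial_span_mono) (auto simp: exponents_def)

lemma poly_funs_le_cong:
  assumes "f \<in> poly_funs_le n d" "\<And>v. v \<in> carrier_vec n \<Longrightarrow> g v = f v"
  shows "g \<in> poly_funs_le n d"
  using assms unfolding poly_funs_le_eq_monomial_span by (rule monomial_span_cong)

lemma poly_funs_le_const: "(\<lambda>v. c) \<in> poly_funs_le n d"
proof -
  have "(\<lambda>v. c * monomial n (\<lambda>i. 0) v) \<in> poly_funs_le n d"
    unfolding poly_funs_le_eq_monomial_span
    by (rule monomial_span_monomial) (simp add: exponents_def)
  then show ?thesis by (simp add: monomial_def)
qed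

lemma poly_funs_le_coord:
  assumes "j < n"
  shows "(\<lambda>v. v $ j) \<in> poly_funs_le n 1"
proof -
  let ?a = "\<lambda>i. if i = j then 1 else 0 :: nat"
  have "(\<lambda>v. 1 * monomial n ?a v) \<in> poly_funs_le n 1"
    unfolding poly_funs_le_eq_monomial_span
    by (rule monomial_span_monomial) (use assms in \<open>auto simp: exponents_def\<close>)
  moreover have "monomial n ?a v = v $ j" for v :: "'a vec"
  proof -
    have "monomial n ?a v = (\<Prod>i<n. if i = j then v $ i else 1)"
      unfolding monomial_def by (intro prod.cong) auto
    also have "\<dots> = v $ j" using assms by (simp add: prod.delta)
    finally show ?thesis .
  qed
  ultimately show ?thesis by (auto intro: poly_funs_le_cong)
qed

lemma poly_funs_le_sum:
  assumes "\<And>i. i \<in> S \<Longrightarrow> f i \<in> poly_funs_le n d"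
  shows "(\<lambda>v. \<Sum>i\<in>S. f i v) \<in> poly_funs_le n d"
  using assms unfolding poly_funs_le_eq_monomial_span by (rule monomial_span_sum)

lemma poly_funs_le_scale: "f \<in> poly_funs_le n d \<Longrightarrow> (\<lambda>v. c * f v) \<in> poly_funs_le n d"
  unfolding poly_funs_le_eq_monomial_span by (rule monomial_span_scale)

lemma poly_funs_le_mult:
  assumes "f \<in> poly_funs_le n d" "g \<in> poly_funs_le n e"
  shows "(\<lambda>v. f v * g v) \<in> poly_funs_le n (d + e)"
  using assms unfolding poly_funs_le_eq_monomial_span
  by (rule monomial_span_mult) (auto simp: exponents_def sum.distrib)

lemma poly_funs_le_power:
  "f \<in> poly_funs_le n d \<Longrightarrow> (\<lambda>v. f v ^ k) \<in> poly_funs_le n (k * d)"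
  by (induction k) (auto intro: poly_funs_le_const poly_funs_le_mult)

lemma poly_funs_le_prod:
  assumes "\<And>i. i \<in> S \<Longrightarrow> f i \<in> poly_funs_le n (d i)"
  shows "(\<lambda>v. \<Prod>i\<in>S. f i v) \<in> poly_funs_le n (\<Sum>i\<in>S. d i)"
  using assms
  by (induction S rule: infinite_finite_induct)
    (auto intro: poly_funs_le_const poly_funs_le_mult)

text \<open>A monomial with exponent \<open>a\<close> turns into a product whose degree is at most
  the sum of the \<open>a i * d\<close>, hence at most \<open>e * d\<close>. The product bound of
  the theorem originates here.\<close>

lemma poly_funs_le_compose:
  assumes F: "F \<in> poly_funs_le m e" and w: "\<And>j. j < m \<Longrightarrow> w j \<in> poly_funs_le n d"
  shows "(\<lambda>v. F (vec m (\<lambda>j. w j v))) \<in> poly_funs_le n (e * d)"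
proof -
  obtain c where c: "\<And>u. u \<in> carrier_vec m \<Longrightarrow>
      F u = (\<Sum>a\<in>exponents m e. c a * (\<Prod>i<m. (u $ i) ^ a i))"
    using F unfolding poly_funs_le_def by blast
  have "(\<lambda>v. \<Prod>i<m. w i v ^ a i) \<in> poly_funs_le n (e * d)" if "a \<in> exponents m e" for a
  proof -
    have "(\<lambda>v. \<Prod>i<m. w i v ^ a i) \<in> poly_funs_le n (\<Sum>i<m. a i * d)"
      by (intro poly_funs_le_prod poly_funs_le_power w) simp
    moreover have "(\<Sum>i<m. a i * d) \<le> e * d"
      using that by (simp add: exponents_def flip: sum_distrib_right)
    ultimately show ?thesis using poly_funs_le_mono by blast
  qed
  then have "(\<lambda>v. \<Sum>a\<in>exponents m e. c a * (\<Prod>i<m. w i v ^ a i)) \<in> poly_funs_le n (e * d)"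
    by (intro poly_funs_le_sum poly_funs_le_scale)
  then show ?thesis
    by (rule poly_funs_le_cong) (simp add: c)
qed

lemma poly_funs_le_mult_mat_vec:
  assumes M: "M \<in> carrier_mat m n" and "i < m"
  shows "(\<lambda>v. (M *\<^sub>v v) $ i) \<in> poly_funs_le n 1"
proof -
  have "(\<lambda>v. \<Sum>j<n. M $$ (i, j) * v $ j) \<in> poly_funs_le n 1"
    by (intro poly_funs_le_sum poly_funs_le_scale poly_funs_le_coord) simp
  then show ?thesis
    by (rule poly_funs_le_cong)
      (use assms in \<open>auto simp: scalar_prod_def atLeast0LessThan intro!: sum.cong\<close>)
qed

lemma poly_funs_le_linear_subst:
  assumes f: "f \<in> poly_funs_le m d" and M: "M \<in> carrier_mat m n"
  shows "(\<lambda>v. f (M *\<^sub>v v)) \<in> poly_funs_le n d"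
proof -
  have "(\<lambda>v. f (vec m (\<lambda>i. (M *\<^sub>v v) $ i))) \<in> poly_funs_le n (d * 1)"
    by (intro poly_funs_le_compose[OF f] poly_funs_le_mult_mat_vec[OF M])
  moreover have "vec m (\<lambda>i. (M *\<^sub>v v) $ i) = M *\<^sub>v v" for v
    using M by auto
  ultimately show ?thesis by simp
qed

subsection \<open>Descending chains of zero sets\<close>

text \<open>A monotone subsequence always exists; if it decreases, it is constant from the point
  where it attains its minimum, and its tail serves.\<close>

lemma nat_seq_incseq_subseq:
  fixes s :: "nat \<Rightarrow> nat"
  obtains r where "strict_mono r" "incseq (\<lambda>k. s (r k))"
proof -
  obtain r where r: "strict_mono r" "monoseq (\<lambda>k. s (r k))"
    using seq_monosub by blast
  from r(2) consider "incseq (\<lambda>k. s (r k))" | "decseq (\<lambda>k. s (r k))"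
    using monoseq_iff by blast
  then show ?thesis
  proof cases
    case 1
    then show ?thesis using r that by blast
  next
    case 2
    obtain N where N: "\<And>k. s (r N) \<le> s (r k)"
      using ex_has_least_nat[of "\<lambda>_. True" _ "\<lambda>k. s (r k)"] by auto
    have "s (r (k + N)) = s (r N)" for k
      using N[of "k + N"] decseqD[OF 2, of N "k + N"] by simp
    moreover have "strict_mono (\<lambda>k. r (k + N))"
      using r(1) by (simp add: strict_mono_def)
    ultimately show ?thesis using that[of "\<lambda>k. r (k + N)"] by (simp add: incseq_def)
  qed
qed

text \<open>The coordinates are made monotone one after another by passing to further subsequences,
  under which those already monotone stay so. The first two terms of the final subsequence are then
  comparable.\<close>

lemma dickson:
  fixes a :: "nat \<Rightarrow> nat \<Rightarrow> nat"
  obtains j k where "j < k" "\<And>i. i < n \<Longrightarrow> a j i \<le> a k i"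
proof -
  have "\<exists>r. strict_mono r \<and> (\<forall>i<n. incseq (\<lambda>k. a (r k) i))"
  proof (induction n)
    case 0
    show ?case by (auto intro: exI[of _ id] simp: strict_mono_def)
  next
    case (Suc n)
    then obtain r where r: "strict_mono r" "\<And>i. i < n \<Longrightarrow> incseq (\<lambda>k. a (r k) i)" by blast
    obtain q where q: "strict_mono q" "incseq (\<lambda>k. a (r (q k)) n)"
      using nat_seq_incseq_subseq[of "\<lambda>k. a (r k) n"] by blast
    have "strict_mono (r \<circ> q)" using r(1) q(1) by (rule strict_mono_o)
    moreover have "incseq (\<lambda>k. a ((r \<circ> q) k) i)" if "i < Suc n" for i
    proof (cases "i = n")
      case False
      then have "incseq (\<lambda>k. a (r k) i)" using that r(2) by simp
      then show ?thesis
        using strict_mono_leD[OF q(1)] by (simp add: incseq_def)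
    qed (use q in simp)
    ultimately show ?case by blast
  qed
  then obtain r where r: "strict_mono r" "\<forall>i<n. incseq (\<lambda>k. a (r k) i)" by blast
  then have "r 0 < r 1" "\<And>i. i < n \<Longrightarrow> a (r 0) i \<le> a (r 1) i"
    by (auto simp: strict_mono_def incseq_def)
  then show ?thesis using that by blast
qed

section \<open>The lexicographic order on exponents\<close>

definition lex_less :: "(nat \<Rightarrow> nat) \<Rightarrow> (nat \<Rightarrow> nat) \<Rightarrow> bool" where
  "lex_less a b \<longleftrightarrow> (\<exists>k. a k < b k \<and> (\<forall>i<k. a i = b i))"

lemma lex_less_trans: "lex_less a b \<Longrightarrow> lex_less b c \<Longrightarrow> lex_less a c"
proof -
  assume "lex_less a b" "lex_less b c"
  then obtain k l where k: "a k < b k" "\<forall>i<k. a i = b i" and l: "b l < c l" "\<forall>i<l. b i = c i"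
    unfolding lex_less_def by blast
  \<comment> \<open>The first index at which \<open>a\<close> and \<open>c\<close> differ is the
    smaller of \<open>k\<close> and \<open>l\<close>.\<close>
  show "lex_less a c"
    unfolding lex_less_def
    by (rule exI[of _ "min k l"]) (use k l in \<open>cases k l rule: linorder_cases; auto\<close>)
qed

text \<open>Compatibility with addition makes this a monomial order, so that multiplying by a
  monomial keeps lower terms lower.\<close>

lemma lex_less_add: "lex_less a b \<Longrightarrow> lex_less (\<lambda>i. d i + a i) (\<lambda>i. d i + b i)"
  unfolding lex_less_def by simp

lemma lex_less_linear: "lex_less a b \<or> a = b \<or> lex_less b a"
proof (rule ccontr)
  assume *: "\<not> ?thesis"
  then have "\<exists>k. a k \<noteq> b k" by auto
  then obtain k where "a k \<noteq> b k" "\<And>i. i < k \<Longrightarrow> a i = b i"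
    using exists_least_iff[of "\<lambda>k. a k \<noteq> b k"] by blast
  then show False using * unfolding lex_less_def by (metis linorder_neqE_nat)
qed

lemma lex_less_not_dominates: "lex_less b a \<Longrightarrow> \<exists>i. b i < a i"
  unfolding lex_less_def by blast

text \<open>In an infinite descending chain, Dickson's lemma finds an earlier exponent that is
  coordinatewise at most a later one, while the later one is lexicographically smaller. The common
  bound \<open>n\<close> on the supports reduces the comparison to finitely many
  coordinates.\<close>

lemma wf_lex_less:
  "wf {(a, b). (\<forall>i\<ge>n. a i = 0) \<and> (\<forall>i\<ge>n. b i = 0) \<and> lex_less a b}"
  unfolding wf_iff_no_infinite_down_chain
proof
  assume "\<exists>f. \<forall>k. (f (Suc k), f k) \<in> {(a, b). (\<forall>i\<ge>n. a i = 0) \<and> (\<forall>i\<ge>n. b i = 0) \<and> lex_less a b}"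
  then obtain f where f: "\<And>k i. n \<le> i \<Longrightarrow> f k i = 0" "\<And>k. lex_less (f (Suc k)) (f k)" by auto
  have less: "lex_less (f k) (f j)" if "j < k" for j k
    using that
  proof (induction k)
    case (Suc k)
    then show ?case using f(2)[of k] lex_less_trans less_Suc_eq by metis
  qed simp
  obtain j k where jk: "j < k" "\<And>i. i < n \<Longrightarrow> f j i \<le> f k i" using dickson[of n f] by metis
  then obtain i where "f k i < f j i" using less lex_less_not_dominates by blast
  then show False using jk(2)[of i] f(1)[of i] by (cases "i < n") auto
qed

section \<open>Leading exponents and the basis theorem\<close>

lemma finite_lex_max:
  assumes "finite T" "T \<noteq> {}"
  shows "\<exists>a\<in>T. \<forall>b\<in>T. b = a \<or> lex_less b a"
  using assms
proof (induction T rule: finite_ne_induct)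
  case (insert x F)
  then obtain a where a: "a \<in> F" "\<forall>b\<in>F. b = a \<or> lex_less b a" by blast
  consider "x = a \<or> lex_less x a" | "lex_less a x" using lex_less_linear[of a x] by blast
  then show ?case
  proof cases
    case 1
    then show ?thesis using a by blast
  next
    case 2
    then have "\<forall>b\<in>F. lex_less b x" using a(2) by (auto intro: lex_less_trans)
    then show ?thesis by blast
  qed
qed simp

text \<open>The largest exponent of a representation serves as \<open>a\<close>. The nonzero value
  only excludes the empty sum; the coefficient at \<open>a\<close> may still be zero.\<close>

lemma monomial_span_lex_bound:
  assumes "f \<in> monomial_span n X" "v \<in> carrier_vec n" "f v \<noteq> 0"
  shows "\<exists>a\<in>X. f \<in> monomial_span n {b \<in> X. b = a \<or> lex_less b a}"
proof -
  obtain T c where T: "finite T" "T \<subseteq> X"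
    "\<forall>v\<in>carrier_vec n. f v = (\<Sum>a\<in>T. c a * monomial n a v)"
    using assms(1) unfolding monomial_span_def by blast
  then have "T \<noteq> {}" using assms(2,3) by auto
  then obtain a where a: "a \<in> T" "\<forall>b\<in>T. b = a \<or> lex_less b a"
    using finite_lex_max T(1) by blast
  then have "T \<subseteq> {b \<in> X. b = a \<or> lex_less b a}" using T(2) by blast
  then have "f \<in> monomial_span n {b \<in> X. b = a \<or> lex_less b a}"
    unfolding monomial_span_def using T by blast
  then show ?thesis using a(1) T(2) by blast
qed

lemma monomial_span_split:
  assumes "f \<in> monomial_span n {b \<in> X. b = a \<or> lex_less b a}"
  shows "\<exists>c. \<exists>r\<in>monomial_span n {b \<in> X. lex_less b a}.
    \<forall>v\<in>carrier_vec n. f v = c * monomial n a v + r v"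
proof -
  obtain T c where T: "finite T" "T \<subseteq> {b \<in> X. b = a \<or> lex_less b a}"
    "\<forall>v\<in>carrier_vec n. f v = (\<Sum>a\<in>T. c a * monomial n a v)"
    using assms(1) unfolding monomial_span_def by blast
  let ?r = "\<lambda>v. \<Sum>a\<in>T - {a}. c a * monomial n a v"
  have "?r \<in> monomial_span n {b \<in> X. lex_less b a}"
    by (intro monomial_span_sum monomial_span_monomial) (use T in auto)
  moreover have "\<forall>v\<in>carrier_vec n. f v = (if a \<in> T then c a else 0) * monomial n a v + ?r v"
    using T by (auto simp: sum.remove)
  ultimately show ?thesis by (intro exI bexI[of _ ?r])
qed

text \<open>
  Hilbert's basis theorem in the guise of leading monomials: choosing each witness with lexicographically
  least leading exponent, Dickson's lemma lets an earlier witness cancel the leading term of a later one.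
\<close>

lemma no_strictly_descending_zero_sets:
  fixes Z :: "nat \<Rightarrow> 'k::field vec set"
  assumes Z: "\<And>k. Z k \<subseteq> carrier_vec n" "\<And>k. Z (Suc k) \<subseteq> Z k"
    and p: "\<And>k. p k \<in> poly_funs n" "\<And>k. \<forall>v\<in>Z (Suc k). p k v = 0" "\<And>k. \<exists>v\<in>Z k. p k v \<noteq> 0"
  shows False
proof -
  define E where "E = {a :: nat \<Rightarrow> nat. \<forall>i\<ge>n. a i = 0}"
  \<comment> \<open>\<open>D k\<close> collects the polynomial witnesses for
    \<open>Z (Suc k)\<close> being strictly smaller than \<open>Z k\<close>, and \<open>M k\<close>
    the exponents that bound such a witness.\<close>
  define D where "D k = {f :: 'k vec \<Rightarrow> 'k. (\<forall>v\<in>Z (Suc k). f v = 0) \<and> (\<exists>v\<in>Z k. f v \<noteq> 0)}" for k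
  define below where
    "below a = (monomial_span n {b \<in> E. lex_less b a} :: ('k vec \<Rightarrow> 'k) set)" for a
  define upto where
    "upto a = (monomial_span n {b \<in> E. b = a \<or> lex_less b a} :: ('k vec \<Rightarrow> 'k) set)" for a
  define M where "M k = {a \<in> E. D k \<inter> upto a \<noteq> {}}" for k
  have below_drop: "\<exists>b\<in>M k. lex_less b a" if f: "f \<in> D k" "f \<in> below a" for f k a
  proof -
    obtain v where v: "v \<in> Z k" "f v \<noteq> 0" using f(1) by (auto simp: D_def)
    then obtain b where b: "b \<in> E" "lex_less b a"
      "f \<in> monomial_span n {b' \<in> {b \<in> E. lex_less b a}. b' = b \<or> lex_less b' b}"
      using monomial_span_lex_bound[OF f(2)[unfolded below_def], of v] Z(1) by blast
    have "f \<in> upto b"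
      unfolding upto_def by (rule subsetD[OF monomial_span_mono b(3)]) auto
    then show ?thesis using b f(1) by (auto simp: M_def)
  qed
  have "\<exists>a\<in>M k. \<forall>b\<in>M k. \<not> lex_less b a" for k
  proof -
    obtain d where "p k \<in> poly_funs_le n d" using p(1) by (auto simp: poly_funs_def)
    then have "p k \<in> monomial_span n E"
      unfolding poly_funs_le_eq_monomial_span
      by (rule subsetD[OF monomial_span_mono, rotated]) (auto simp: exponents_def E_def)
    moreover obtain v where "v \<in> Z k" "p k v \<noteq> 0" using p(3) by blast
    ultimately obtain a where "a \<in> E" "p k \<in> upto a"
      using monomial_span_lex_bound[of "p k" n E v] Z(1) unfolding upto_def by blast
    moreover have "p k \<in> D k" using p(2,3) by (simp add: D_def)
    ultimately have "a \<in> M k" by (auto simp: M_def)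
    then show ?thesis
    proof (rule wfE_min[OF wf_lex_less[of n]])
      fix z assume z: "z \<in> M k" and min: "\<And>y. (y, z) \<in> {(a, b). (\<forall>i\<ge>n. a i = 0) \<and>
          (\<forall>i\<ge>n. b i = 0) \<and> lex_less a b} \<Longrightarrow> y \<notin> M k"
      have "\<not> lex_less b z" if "b \<in> M k" for b
      proof -
        have "\<forall>i\<ge>n. b i = 0" "\<forall>i\<ge>n. z i = 0"
          using that z unfolding M_def E_def by simp_all
        then show ?thesis using that min[of b] by auto
      qed
      then show ?thesis using z by blast
    qed
  qed
  then obtain a where a: "\<And>k. a k \<in> M k" "\<And>k b. b \<in> M k \<Longrightarrow> \<not> lex_less b (a k)" by metis
  then have "\<exists>f. f \<in> D k \<and> f \<in> upto (a k)" for k unfolding M_def by blast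
  then obtain f where f: "\<And>k. f k \<in> D k" "\<And>k. f k \<in> upto (a k)" by metis
  have "\<exists>c. \<exists>r\<in>below (a k). \<forall>v\<in>carrier_vec n. f k v = c * monomial n (a k) v + r v" for k
    using monomial_span_split f(2) unfolding below_def upto_def by blast
  then obtain c r where r: "\<And>k. r k \<in> below (a k)"
    and fr: "\<And>k v. v \<in> carrier_vec n \<Longrightarrow> f k v = c k * monomial n (a k) v + r k v" by metis
  \<comment> \<open>Otherwise \<open>f k\<close> would be supported strictly below
    \<open>a k\<close>, and \<open>below_drop\<close> would contradict the minimal choice of
    \<open>a k\<close>.\<close>
  have c: "c k \<noteq> 0" for k
  proof
    assume "c k = 0"
    then have "f k \<in> below (a k)"
      using monomial_span_cong[of "r k" n _ "f k"] r fr unfolding below_def by simp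
    then show False using below_drop[OF f(1)] a(2) by blast
  qed
  obtain j k where jk: "j < k" "\<And>i. i < n \<Longrightarrow> a j i \<le> a k i" using dickson[of n a] by metis
  define d where "d i = a k i - a j i" for i
  have aE: "a k \<in> E" for k using a(1) by (auto simp: M_def)
  have d: "d \<in> E" using aE by (auto simp: d_def E_def)
  have ak: "(\<lambda>i. d i + a j i) = a k"
  proof
    fix i show "d i + a j i = a k i"
      using jk(2)[of i] aE by (cases "i < n") (auto simp: d_def E_def)
  qed
  \<comment> \<open>Since \<open>d\<close> is the difference of \<open>a k\<close> and
    \<open>a j\<close>, the terms with exponent \<open>a k\<close> cancel, and what remains is
    supported strictly below \<open>a k\<close>.\<close>
  define g where "g v = f k v - c k / c j * monomial n d v * f j v" for v
  have "(\<lambda>v. monomial n d v * r j v) \<in> below (a k)"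
  proof -
    have "(\<lambda>v. 1 * monomial n d v * r j v) \<in> below (a k)"
      unfolding below_def
      by (rule monomial_span_mult[OF monomial_span_monomial[of d "{d}"] r[unfolded below_def]])
        (use d lex_less_add ak[symmetric] in \<open>auto simp: E_def\<close>)
    then show ?thesis by simp
  qed
  then have "(\<lambda>v. r k v + (- (c k / c j)) * (monomial n d v * r j v)) \<in> below (a k)"
    using r[of k] unfolding below_def by (intro monomial_span_add monomial_span_scale)
  moreover have "g v = r k v + (- (c k / c j)) * (monomial n d v * r j v)"
    if v: "v \<in> carrier_vec n" for v
  proof -
    have "monomial n (a k) v = monomial n d v * monomial n (a j) v"
      by (subst ak[symmetric]) (rule monomial_add)
    moreover have "c k / c j * monomial n d v * (c j * monomial n (a j) v) =
        c k * (monomial n d v * monomial n (a j) v)"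
      using c[of j] by simp
    ultimately show ?thesis
      unfolding g_def fr[OF v] distrib_left by (simp only: mult.assoc) simp
  qed
  ultimately have "g \<in> below (a k)"
    unfolding below_def by (rule monomial_span_cong)
  moreover have "g \<in> D k"
  proof -
    \<comment> \<open>As \<open>j < k\<close>, the function \<open>f j\<close> vanishes on all of
      \<open>Z k\<close>. There \<open>g\<close> agrees with \<open>f k\<close>, so it is still a
      witness, now with a smaller leading exponent.\<close>
    have "Z k \<subseteq> Z (Suc j)" 
      by (rule lift_Suc_antimono_le[of Z, OF Z(2)]) (use jk(1) in simp)
    moreover have "f j v = 0" if "v \<in> Z (Suc j)" for v using that f(1)[of j] by (simp add: D_def)
    ultimately have gf: "g v = f k v" if "v \<in> Z k" for v
      using that unfolding g_def by (metis mult_zero_right diff_zero subsetD)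
    obtain v where "v \<in> Z k" "f k v \<noteq> 0" using f(1)[of k] by (auto simp: D_def)
    then have "\<exists>v\<in>Z k. g v \<noteq> 0" using gf by auto
    moreover have "g v = 0" if "v \<in> Z (Suc k)" for v
      using that gf[of v] Z(2)[of k] f(1)[of k] by (simp add: D_def subsetD)
    ultimately show ?thesis by (simp add: D_def)
  qed
  ultimately show False using below_drop a(2) by blast
qed

subsection \<open>The delta number\<close>

lemma delta_set_mono:
  assumes "delta_set G n \<rho> (invariants_le G n \<rho> d)" "d \<le> e"
  shows "delta_set G n \<rho> (invariants_le G n \<rho> e)"
proof -
  have "zero_const n (invariants_le G n \<rho> d) \<subseteq> zero_const n (invariants_le G n \<rho> e)"
    using poly_funs_le_mono[OF assms(2)] by (auto simp: zero_const_def invariants_le_def)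
  moreover have "invariants_le G n \<rho> e \<subseteq> invariants G n \<rho>" by (simp add: invariants_le_def)
  ultimately show ?thesis using assms(1) unfolding delta_set_def by blast
qed

text \<open>A finite bound excludes the empty index set, whose infimum is \<infinity>. Over a
  nonempty set the infimum is attained, and \<open>delta_set_mono\<close> passes from the attained
  degree to \<open>d\<close>.\<close>

lemma delta_rep_le_iff:
  "delta_rep G n \<rho> \<le> enat d \<longleftrightarrow> delta_set G n \<rho> (invariants_le G n \<rho> d)"
proof
  let ?D = "enat ` {d. delta_set G n \<rho> (invariants_le G n \<rho> d)}"
  assume le: "delta_rep G n \<rho> \<le> enat d"
  then have "?D \<noteq> {}" using top_enat_def by (fastforce simp: delta_rep_def Inf_enat_def)
  then have "Inf ?D \<in> ?D" unfolding Inf_enat_def by (auto intro: LeastI)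
  then show "delta_set G n \<rho> (invariants_le G n \<rho> d)"
    using le delta_set_mono unfolding delta_rep_def by auto
next
  assume "delta_set G n \<rho> (invariants_le G n \<rho> d)"
  then show "delta_rep G n \<rho> \<le> enat d" unfolding delta_rep_def by (auto intro: INF_lower)
qed

lemma delta_le_iff:
  "delta G \<le> enat d \<longleftrightarrow>
     (\<forall>n \<rho>. rational_rep G n \<rho> \<longrightarrow> delta_set G n \<rho> (invariants_le G n \<rho> d))"
  unfolding delta_def SUP_le_iff by (auto simp: delta_rep_le_iff)

section \<open>Actions and invariants of rational representations\<close>

lemma rational_rep_mult_vec:
  assumes "rational_rep G n \<rho>" "g \<in> carrier G" "h \<in> carrier G" "v \<in> carrier_vec n"
  shows "\<rho> (g \<otimes>\<^bsub>G\<^esub> h) *\<^sub>v v = \<rho> g *\<^sub>v (\<rho> h *\<^sub>v v)"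
proof -
  have "\<rho> (g \<otimes>\<^bsub>G\<^esub> h) = \<rho> g * \<rho> h" "\<rho> g \<in> carrier_mat n n" "\<rho> h \<in> carrier_mat n n"
    using assms(1-3) unfolding rational_rep_def by auto
  then show ?thesis using assms(4) by (simp add: assoc_mult_mat_vec[of _ n n _ n])
qed

lemma rational_rep_mult_vec_closed:
  assumes "rational_rep G n \<rho>" "g \<in> carrier G" "v \<in> carrier_vec n"
  shows "\<rho> g *\<^sub>v v \<in> carrier_vec n"
proof -
  have "\<rho> g \<in> carrier_mat n n" using assms unfolding rational_rep_def by simp
  then show ?thesis using assms by simp
qed

lemma rational_rep_mult_zero_vec:
  assumes "rational_rep G n \<rho>" "g \<in> carrier G"
  shows "\<rho> g *\<^sub>v 0\<^sub>v n = 0\<^sub>v n"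
proof -
  have "\<rho> g \<in> carrier_mat n n" using assms unfolding rational_rep_def by simp
  then show ?thesis by auto
qed

lemma invariants_iff:
  assumes "group G"
  shows "f \<in> invariants G n \<rho> \<longleftrightarrow>
    f \<in> poly_funs n \<and> (\<forall>g\<in>carrier G. \<forall>v\<in>carrier_vec n. f (\<rho> g *\<^sub>v v) = f v)"
proof -
  interpret group G by fact
  have "(\<forall>g\<in>carrier G. P (inv\<^bsub>G\<^esub> g)) \<longleftrightarrow> (\<forall>g\<in>carrier G. P g)" for P
    by (metis (no_types) inv_closed inv_inv)
  from this[of "\<lambda>g. \<forall>v\<in>carrier_vec n. f (\<rho> g *\<^sub>v v) = f v"] show ?thesis
    by (simp add: invariants_def fun_action_def)
qed

text \<open>The witness is the product of the translates of a coordinate function over the group.\<close>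

lemma finite_group_separating_invariant:
  assumes G: "group G" "finite (carrier G)" and rep: "rational_rep G n \<rho>"
    and v: "v \<in> fixed_points G n \<rho>" "v \<noteq> 0\<^sub>v n"
  shows "\<exists>f\<in>zero_const n (invariants_le G n \<rho> (card (carrier G))). f v \<noteq> 0"
proof -
  interpret group G by fact
  have vc: "v \<in> carrier_vec n" using v(1) by (simp add: fixed_points_def)
  then obtain i where i: "i < n" "v $ i \<noteq> 0" using v(2) eq_vecI[of v "0\<^sub>v n"] by auto
  define f where "f u = (\<Prod>q\<in>carrier G. (\<rho> q *\<^sub>v u) $ i)" for u
  have \<rho>: "\<rho> q \<in> carrier_mat n n" if "q \<in> carrier G" for q
    using rep that by (auto simp: rational_rep_def)
  have "f \<in> poly_funs_le n (\<Sum>q\<in>carrier G. 1)"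
    unfolding f_def by (intro poly_funs_le_prod poly_funs_le_mult_mat_vec[OF \<rho>] i)
  then have deg: "f \<in> poly_funs_le n (card (carrier G))" by simp
  have "f (\<rho> g *\<^sub>v u) = f u" if g: "g \<in> carrier G" and u: "u \<in> carrier_vec n" for g u
  proof -
    have "f (\<rho> g *\<^sub>v u) = (\<Prod>q\<in>carrier G. (\<rho> (q \<otimes>\<^bsub>G\<^esub> g) *\<^sub>v u) $ i)"
      unfolding f_def using rational_rep_mult_vec[OF rep _ g u] by simp
    also have "\<dots> = f u"
      unfolding f_def
      by (rule prod.reindex_bij_witness[of _ "\<lambda>q. q \<otimes>\<^bsub>G\<^esub> inv\<^bsub>G\<^esub> g" "\<lambda>q. q \<otimes>\<^bsub>G\<^esub> g"])
        (use g in \<open>auto simp: m_assoc\<close>)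
    finally show ?thesis .
  qed
  then have "f \<in> invariants_le G n \<rho> (card (carrier G))"
    using deg by (auto simp: invariants_le_def invariants_iff[OF G(1)] poly_funs_def)
  moreover have "f (0\<^sub>v n) = 0"
    unfolding f_def using i(1) G(2) rational_rep_mult_zero_vec[OF rep] one_closed
    by (intro prod_zero) auto
  \<comment> \<open>At a fixed point every factor equals \<open>v $ i\<close>, so the value is a
    power of a nonzero scalar. Unlike a sum over the group, the product therefore cannot vanish
    there in positive characteristic.\<close>
  moreover have "f v \<noteq> 0"
    using v(1) i G(2) by (simp add: f_def fixed_points_def)
  ultimately show ?thesis by (auto simp: zero_const_def)
qed

lemma zero_vec_in_nullcone: "0\<^sub>v n \<in> nullcone G n \<rho>"
  by (simp add: nullcone_def zero_const_def)

lemma finite_group_nullcone: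
  assumes "group G" "finite (carrier G)" "rational_rep G n \<rho>"
    and "v \<in> fixed_points G n \<rho>" "v \<noteq> 0\<^sub>v n"
  shows "v \<notin> nullcone G n \<rho>"
  using finite_group_separating_invariant[OF assms]
  by (auto simp: nullcone_def zero_const_def invariants_le_def)

text \<open>A fixed point outside the nullcone is nonzero, and the product of translates detects it
  in degree the group order. This makes the factor of the quotient finite.\<close>

lemma delta_finite_group_le:
  assumes "group G" "finite (carrier G)"
  shows "delta G \<le> enat (card (carrier G))"
  unfolding delta_le_iff delta_set_def
proof (intro allI impI conjI ballI)
  fix n \<rho> v assume "rational_rep G n \<rho>" "v \<in> fixed_points G n \<rho> - nullcone G n \<rho>"
  moreover from this have "v \<noteq> 0\<^sub>v n" using zero_vec_in_nullcone by blast
  ultimately show "\<exists>f\<in>zero_const n (invariants_le G n \<rho> (card (carrier G))). f v \<noteq> 0"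
    using finite_group_separating_invariant[OF assms] by blast
qed (simp add: invariants_le_def)

text \<open>The trivial one-dimensional module already requires an invariant of degree one.\<close>

lemma delta_pos:
  assumes const: "\<And>c. (\<lambda>x. c) \<in> coord_ring G"
  shows "delta G \<noteq> 0"
proof
  assume "delta G = 0"
  then have "delta G \<le> enat 0" by (simp add: zero_enat_def)
  define \<rho> where "\<rho> g = (1\<^sub>m 1 :: 'a mat)" for g :: 'b
  have "rational_rep G 1 \<rho>"
    by (auto simp: rational_rep_def \<rho>_def const)
  then have d: "delta_set G 1 \<rho> (invariants_le G 1 \<rho> 0)"
    using \<open>delta G \<le> enat 0\<close> delta_le_iff by blast
  define v :: "'a vec" where "v = unit_vec 1 0"
  have "(\<lambda>v. v $ 0) \<in> invariants G 1 \<rho>"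
    using poly_funs_le_coord[of 0 1] by (auto simp: invariants_def fun_action_def \<rho>_def poly_funs_def)
  then have "(\<lambda>v. v $ 0) \<in> zero_const 1 (invariants G 1 \<rho>)" by (simp add: zero_const_def)
  moreover have "v $ 0 \<noteq> 0" by (simp add: v_def)
  ultimately have "v \<notin> nullcone G 1 \<rho>" by (auto simp: nullcone_def)
  moreover have "v \<in> fixed_points G 1 \<rho>" by (auto simp: fixed_points_def \<rho>_def v_def)
  ultimately obtain f where f: "f \<in> poly_funs_le 1 0" "f (0\<^sub>v 1) = 0" "f v \<noteq> 0"
    using d by (auto simp: delta_set_def zero_const_def invariants_le_def)
  \<comment> \<open>Only the zero exponent has degree zero, so \<open>f\<close> is constant, which
    is incompatible with \<open>f\<close> vanishing at the origin but not at
    \<open>v\<close>.\<close>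
  have "exponents 1 0 = {\<lambda>_. 0}"
  proof -
    have "a i = 0" if "\<forall>i\<ge>1. a i = 0" "a 0 = 0" for a :: "nat \<Rightarrow> nat" and i
      using that by (cases i) auto
    then show ?thesis by (auto simp: exponents_def fun_eq_iff)
  qed
  then have "\<exists>c. \<forall>v\<in>carrier_vec 1. f v = c"
    using f(1) by (auto simp: poly_funs_le_def)
  then show False using f(2,3) by (auto simp: v_def)
qed

subsection \<open>Regular functions and the Zariski topology\<close>

locale lin_alg_group = group G for G :: "('g, 'k::field) alg_group" (structure) +
  assumes lin_alg: "linear_algebraic_group G"
begin

lemma coord_ring_cong:
  assumes "f \<in> coord_ring G" "\<And>x. x \<in> carrier G \<Longrightarrow> g x = f x"
  shows "g \<in> coord_ring G"
proof -
  obtain n \<phi> where "coord_ring G = {f. \<exists>p\<in>poly_funs n. \<forall>x\<in>carrier G. f x = p (\<phi> x)}"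
    using lin_alg unfolding linear_algebraic_group_def affine_variety_def by blast
  then show ?thesis using assms by simp
qed

lemma coord_ring_const: "(\<lambda>x. c) \<in> coord_ring G"
proof -
  obtain n \<phi> where "coord_ring G = {f. \<exists>p\<in>poly_funs n. \<forall>x\<in>carrier G. f x = p (\<phi> x)}"
    using lin_alg unfolding linear_algebraic_group_def affine_variety_def by blast
  moreover have "(\<lambda>v. c) \<in> poly_funs n"
    using poly_funs_le_const[of c n] by (auto simp: poly_funs_def)
  ultimately show ?thesis by auto
qed

lemma coord_ring_add:
  assumes "f \<in> coord_ring G" "g \<in> coord_ring G"
  shows "(\<lambda>x. f x + g x) \<in> coord_ring G"
proof -
  obtain n \<phi> where A: "coord_ring G = {f. \<exists>p\<in>poly_funs n. \<forall>x\<in>carrier G. f x = p (\<phi> x)}"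
    using lin_alg unfolding linear_algebraic_group_def affine_variety_def by blast
  then obtain p q where p: "p \<in> poly_funs n" "\<forall>x\<in>carrier G. f x = p (\<phi> x)"
    and q: "q \<in> poly_funs n" "\<forall>x\<in>carrier G. g x = q (\<phi> x)"
    using assms by auto
  obtain d e where "p \<in> poly_funs_le n d" "q \<in> poly_funs_le n e"
    using p(1) q(1) by (auto simp: poly_funs_def)
  then have "p \<in> poly_funs_le n (max d e)" "q \<in> poly_funs_le n (max d e)"
    using poly_funs_le_mono[of d "max d e" n] poly_funs_le_mono[of e "max d e" n] by auto
  then have "(\<lambda>v. p v + q v) \<in> poly_funs n"
    unfolding poly_funs_def poly_funs_le_eq_monomial_span by (blast intro: monomial_span_add)
  then show ?thesis unfolding A using p(2) q(2) by auto
qed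

lemma coord_ring_mult:
  assumes "f \<in> coord_ring G" "g \<in> coord_ring G"
  shows "(\<lambda>x. f x * g x) \<in> coord_ring G"
proof -
  obtain n \<phi> where A: "coord_ring G = {f. \<exists>p\<in>poly_funs n. \<forall>x\<in>carrier G. f x = p (\<phi> x)}"
    using lin_alg unfolding linear_algebraic_group_def affine_variety_def by blast
  then obtain p q where p: "p \<in> poly_funs n" "\<forall>x\<in>carrier G. f x = p (\<phi> x)"
    and q: "q \<in> poly_funs n" "\<forall>x\<in>carrier G. g x = q (\<phi> x)"
    using assms by auto
  have "(\<lambda>v. p v * q v) \<in> poly_funs n" using p(1) q(1) by (rule poly_funs_mult)
  then show ?thesis unfolding A using p(2) q(2) by auto
qed

lemma coord_ring_sum:
  "(\<And>i. i \<in> S \<Longrightarrow> f i \<in> coord_ring G) \<Longrightarrow> (\<lambda>x. \<Sum>i\<in>S. f i x) \<in> coord_ring G"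
  by (induction S rule: infinite_finite_induct) (auto intro: coord_ring_const coord_ring_add)

lemma coord_ring_prod:
  "(\<And>i. i \<in> S \<Longrightarrow> f i \<in> coord_ring G) \<Longrightarrow> (\<lambda>x. \<Prod>i\<in>S. f i x) \<in> coord_ring G"
  by (induction S rule: infinite_finite_induct) (auto intro: coord_ring_const coord_ring_mult)

lemma coord_ring_power: "f \<in> coord_ring G \<Longrightarrow> (\<lambda>x. f x ^ k) \<in> coord_ring G"
  by (induction k) (auto intro: coord_ring_const coord_ring_mult)

lemma coord_ring_inv: "f \<in> coord_ring G \<Longrightarrow> (\<lambda>x. f (inv x)) \<in> coord_ring G"
  using lin_alg unfolding linear_algebraic_group_def by blast

lemma coord_ring_comultiplication:
  assumes "f \<in> coord_ring G"
  obtains m :: nat and a b where "\<And>i. i < m \<Longrightarrow> a i \<in> coord_ring G" "\<And>i. i < m \<Longrightarrow> b i \<in> coord_ring G"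
    "\<And>x y. x \<in> carrier G \<Longrightarrow> y \<in> carrier G \<Longrightarrow> f (x \<otimes> y) = (\<Sum>i<m. a i x * b i y)"
proof -
  have "(\<lambda>(x, y). f (x \<otimes> y)) \<in> product_coord_ring (carrier G) (coord_ring G)"
    using lin_alg assms unfolding linear_algebraic_group_def by blast
  then obtain m :: nat and a b where "\<forall>i<m. a i \<in> coord_ring G \<and> b i \<in> coord_ring G"
    "\<forall>x\<in>carrier G. \<forall>y\<in>carrier G. f (x \<otimes> y) = (\<Sum>i<m. a i x * b i y)"
    unfolding product_coord_ring_def by auto
  then show ?thesis using that by blast
qed

text \<open>Fixing the first argument in the comultiplication leaves a linear combination of regular
  functions of the second.\<close>

lemma coord_ring_left_translate:
  assumes f: "f \<in> coord_ring G" and g: "g \<in> carrier G"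
  shows "(\<lambda>x. f (g \<otimes> x)) \<in> coord_ring G"
proof -
  obtain m :: nat and a b where ab: "\<And>i. i < m \<Longrightarrow> a i \<in> coord_ring G"
    "\<And>i. i < m \<Longrightarrow> b i \<in> coord_ring G"
    "\<And>x y. x \<in> carrier G \<Longrightarrow> y \<in> carrier G \<Longrightarrow> f (x \<otimes> y) = (\<Sum>i<m. a i x * b i y)"
    using coord_ring_comultiplication[OF f] by blast
  have "(\<lambda>x. \<Sum>i<m. a i g * b i x) \<in> coord_ring G"
    by (intro coord_ring_sum coord_ring_mult coord_ring_const ab(2)) simp
  then show ?thesis by (rule coord_ring_cong) (simp add: ab(3) g)
qed

lemma coord_ring_right_translate:
  assumes f: "f \<in> coord_ring G" and g: "g \<in> carrier G"
  shows "(\<lambda>x. f (x \<otimes> g)) \<in> coord_ring G"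
proof -
  obtain m :: nat and a b where ab: "\<And>i. i < m \<Longrightarrow> a i \<in> coord_ring G"
    "\<And>i. i < m \<Longrightarrow> b i \<in> coord_ring G"
    "\<And>x y. x \<in> carrier G \<Longrightarrow> y \<in> carrier G \<Longrightarrow> f (x \<otimes> y) = (\<Sum>i<m. a i x * b i y)"
    using coord_ring_comultiplication[OF f] by blast
  have "(\<lambda>x. \<Sum>i<m. a i x * b i g) \<in> coord_ring G"
    by (intro coord_ring_sum coord_ring_mult coord_ring_const ab(1)) simp
  then show ?thesis by (rule coord_ring_cong) (simp add: ab(3) g)
qed

lemma coord_ring_poly_compose:
  assumes p: "p \<in> poly_funs m" and u: "\<And>j. j < m \<Longrightarrow> u j \<in> coord_ring G"
  shows "(\<lambda>x. p (vec m (\<lambda>j. u j x))) \<in> coord_ring G"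
proof -
  obtain d c where c: "\<And>v. v \<in> carrier_vec m \<Longrightarrow>
      p v = (\<Sum>a\<in>exponents m d. c a * (\<Prod>i<m. (v $ i) ^ a i))"
    using p by (auto simp: poly_funs_def poly_funs_le_def)
  have "(\<lambda>x. \<Sum>a\<in>exponents m d. c a * (\<Prod>i<m. u i x ^ a i)) \<in> coord_ring G"
    by (intro coord_ring_sum coord_ring_mult coord_ring_const coord_ring_prod coord_ring_power u) simp
  then show ?thesis by (rule coord_ring_cong) (simp add: c)
qed

text \<open>The coordinates of \<open>\<rho> x *\<^sub>v v\<close> are linear combinations of matrix
  entries, which are regular in \<open>x\<close>. Thus a polynomial on the module is turned into a
  regular function on the group.\<close>

lemma coord_ring_orbit_map:
  assumes rep: "rational_rep G n \<rho>" and f: "f \<in> poly_funs n" and v: "v \<in> carrier_vec n"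
  shows "(\<lambda>x. f (\<rho> x *\<^sub>v v)) \<in> coord_ring G"
proof -
  have "(\<lambda>x. f (vec n (\<lambda>i. \<Sum>j<n. \<rho> x $$ (i, j) * v $ j))) \<in> coord_ring G"
    using rep by (intro coord_ring_poly_compose[OF f] coord_ring_sum coord_ring_mult coord_ring_const)
      (auto simp: rational_rep_def)
  then show ?thesis
  proof (rule coord_ring_cong)
    fix x assume "x \<in> carrier G"
    then have "\<rho> x \<in> carrier_mat n n" using rep by (simp add: rational_rep_def)
    then have "\<rho> x *\<^sub>v v = vec n (\<lambda>i. \<Sum>j<n. \<rho> x $$ (i, j) * v $ j)"
      using v by (auto simp: scalar_prod_def atLeast0LessThan)
    then show "f (\<rho> x *\<^sub>v v) = f (vec n (\<lambda>i. \<Sum>j<n. \<rho> x $$ (i, j) * v $ j))" by simp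
  qed
qed

section \<open>Closed sets, continuous maps and translations\<close>

lemma topspace_zariski: "topspace (zariski_topology G) = carrier G"
proof -
  have "openin (zariski_topology G) (carrier G)"
    unfolding openin_zariski_topology[OF lin_alg]
    by (rule exI[of _ "{\<lambda>x. 1}"]) (auto simp: coord_ring_const)
  moreover have "topspace (zariski_topology G) \<subseteq> carrier G"
    unfolding topspace_def openin_zariski_topology[OF lin_alg] by auto
  ultimately show ?thesis using openin_subset by blast
qed

lemma closedin_zariski:
  "closedin (zariski_topology G) C \<longleftrightarrow>
    (\<exists>S\<subseteq>coord_ring G. C = {x \<in> carrier G. \<forall>f\<in>S. f x = 0})"
proof -
  have "C \<subseteq> X \<and> X - C = X - Z \<longleftrightarrow> C = Z" if "Z \<subseteq> X" for X Z using that by blast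
  from this[of "{x \<in> carrier G. \<forall>f\<in>S. f x = 0}" "carrier G" for S :: "('g \<Rightarrow> 'k) set"]
  have eq: "C \<subseteq> carrier G \<and> carrier G - C = carrier G - {x \<in> carrier G. \<forall>f\<in>S. f x = 0} \<longleftrightarrow>
      C = {x \<in> carrier G. \<forall>f\<in>S. f x = 0}" for S :: "('g \<Rightarrow> 'k) set"
    by simp
  show ?thesis
    unfolding closedin_def topspace_zariski openin_zariski_topology[OF lin_alg] eq[symmetric]
    by (rule iffI; elim conjE exE; intro exI conjI; assumption)
qed

lemma continuous_map_zariski:
  assumes h: "h \<in> carrier G \<rightarrow> carrier G"
    and A: "\<And>f. f \<in> coord_ring G \<Longrightarrow> (\<lambda>x. f (h x)) \<in> coord_ring G"
  shows "continuous_map (zariski_topology G) (zariski_topology G) h"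
  unfolding continuous_map_closedin topspace_zariski
proof (intro conjI allI impI)
  fix C assume "closedin (zariski_topology G) C"
  then obtain S where S: "S \<subseteq> coord_ring G" "C = {x \<in> carrier G. \<forall>f\<in>S. f x = 0}"
    unfolding closedin_zariski by blast
  have "{x \<in> carrier G. h x \<in> C} = {x \<in> carrier G. \<forall>f\<in>(\<lambda>f x. f (h x)) ` S. f x = 0}"
    using h by (auto simp: S(2))
  moreover have "(\<lambda>f x. f (h x)) ` S \<subseteq> coord_ring G" using A S(1) by auto
  ultimately show "closedin (zariski_topology G) {x \<in> carrier G. h x \<in> C}"
    unfolding closedin_zariski by blast
qed (rule h)

text \<open>Translations pull regular functions back to regular functions, hence are continuous.
  Connectedness is transported by translations alone, because multiplication is in general not
  continuous for the product of the Zariski topologies.\<close>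

lemma connectedin_left_translate:
  assumes "connectedin (zariski_topology G) S" "g \<in> carrier G"
  shows "connectedin (zariski_topology G) ((\<lambda>x. g \<otimes> x) ` S)"
  using assms
  by (intro connectedin_continuous_map_image[OF continuous_map_zariski])
    (auto intro: coord_ring_left_translate)

lemma connectedin_right_translate:
  assumes "connectedin (zariski_topology G) S" "g \<in> carrier G"
  shows "connectedin (zariski_topology G) ((\<lambda>x. x \<otimes> g) ` S)"
  using assms
  by (intro connectedin_continuous_map_image[OF continuous_map_zariski])
    (auto intro: coord_ring_right_translate)

section \<open>The identity component as a normal subgroup\<close>

lemma connectedin_identity_component:
  "connectedin (zariski_topology G) (identity_component G)"
  unfolding identity_component_def by (rule connectedin_connected_component_of)

lemma identity_component_maximal:
  assumes "connectedin (zariski_topology G) S" "\<one> \<in> S"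
  shows "S \<subseteq> identity_component G"
  using assms unfolding identity_component_def by (rule connected_component_of_maximal)

lemma one_in_identity_component: "\<one> \<in> identity_component G"
  unfolding identity_component_def
  by (simp add: connected_component_of_refl topspace_zariski)

lemma identity_component_subset: "identity_component G \<subseteq> carrier G"
  using connectedin_subset_topspace[OF connectedin_identity_component]
  unfolding topspace_zariski .

text \<open>Translating the component by \<open>inv a\<close> gives a connected set that contains
  \<one> as the image of \<open>a\<close>; by maximality it lies in the component.\<close>

lemma identity_component_inv_mult:
  assumes "a \<in> identity_component G" "b \<in> identity_component G"
  shows "inv a \<otimes> b \<in> identity_component G"
proof -
  have a: "a \<in> carrier G" using assms(1) identity_component_subset by blast
  have "(\<lambda>x. inv a \<otimes> x) ` identity_component G \<subseteq> identity_component G"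
    using assms(1) a
    by (intro identity_component_maximal connectedin_left_translate connectedin_identity_component)
      (auto intro!: image_eqI[of _ _ a])
  then show ?thesis using assms(2) by blast
qed

lemma subgroup_identity_component: "subgroup (identity_component G) G"
proof
  have inv: "inv a \<in> identity_component G" if "a \<in> identity_component G" for a
    using identity_component_inv_mult[OF that one_in_identity_component] that
      identity_component_subset by (auto simp: subset_iff)
  then show "inv a \<in> identity_component G" if "a \<in> identity_component G" for a using that .
  show "a \<otimes> b \<in> identity_component G"
    if "a \<in> identity_component G" "b \<in> identity_component G" for a b
    using identity_component_inv_mult[OF inv that(2)] that identity_component_subset
    by (auto simp: subset_iff)
qed (use identity_component_subset one_in_identity_component in auto)

text \<open>Conjugation is a left translation followed by a right one and fixes \<one>, so it maps
  the component into itself.\<close>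

lemma normal_identity_component: "identity_component G \<lhd> G"
  unfolding normal_inv_iff
proof (intro conjI ballI subgroup_identity_component)
  fix x h assume x: "x \<in> carrier G" and h: "h \<in> identity_component G"
  have "(\<lambda>y. y \<otimes> inv x) ` ((\<lambda>y. x \<otimes> y) ` identity_component G) \<subseteq> identity_component G"
    using x one_in_identity_component
    by (intro identity_component_maximal connectedin_left_translate connectedin_right_translate
        connectedin_identity_component) (auto simp: image_image intro!: image_eqI[of _ _ \<one>])
  then show "x \<otimes> h \<otimes> inv x \<in> identity_component G" using h by (simp add: image_subset_iff)
qed

section \<open>The Noetherian property and finiteness of the index\<close>

text \<open>The embedding \<open>\<phi>\<close> into affine space carries a strictly descending
  chain to subsets of \<open>carrier_vec n\<close>, with a polynomial separating each set from the
  next; such a chain is impossible by \<open>no_strictly_descending_zero_sets\<close>.\<close>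

lemma wf_closedin_zariski:
  "wf {(C, D). closedin (zariski_topology G) C \<and> closedin (zariski_topology G) D \<and> C \<subset> D}"
  unfolding wf_iff_no_infinite_down_chain
proof
  assume "\<exists>C. \<forall>k. (C (Suc k), C k) \<in>
    {(C, D). closedin (zariski_topology G) C \<and> closedin (zariski_topology G) D \<and> C \<subset> D}"
  then obtain C where C: "\<forall>k. (C (Suc k), C k) \<in>
    {(C, D). closedin (zariski_topology G) C \<and> closedin (zariski_topology G) D \<and> C \<subset> D}"
    by (elim exE)
  have cl: "closedin (zariski_topology G) (C k)" for k using C by simp
  have less: "C (Suc k) \<subset> C k" for k using C by simp
  obtain n \<phi> and I :: "('k vec \<Rightarrow> 'k) set" where
    \<phi>: "bij_betw \<phi> (carrier G) {v \<in> carrier_vec n. \<forall>p\<in>I. p v = 0}" and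
    A: "coord_ring G = {f. \<exists>p\<in>poly_funs n. \<forall>x\<in>carrier G. f x = p (\<phi> x)}"
    using lin_alg unfolding linear_algebraic_group_def affine_variety_def by blast
  have sub: "C k \<subseteq> carrier G" for k using closedin_subset[OF cl] topspace_zariski by simp
  have "\<exists>p\<in>poly_funs n. (\<forall>x\<in>C (Suc k). p (\<phi> x) = 0) \<and> (\<exists>x\<in>C k. p (\<phi> x) \<noteq> 0)" for k
  proof -
    obtain S where S: "S \<subseteq> coord_ring G" "C (Suc k) = {x \<in> carrier G. \<forall>f\<in>S. f x = 0}"
      using cl[of "Suc k"] unfolding closedin_zariski by blast
    obtain x where x: "x \<in> C k" "x \<notin> C (Suc k)" using less[of k] by blast
    then have "x \<in> carrier G" using sub[of k] by blast
    then obtain f where f: "f \<in> S" "f x \<noteq> 0" using S(2) x(2) by auto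
    then obtain p where p: "p \<in> poly_funs n" "\<forall>x\<in>carrier G. f x = p (\<phi> x)" using S(1) A by auto
    have "\<forall>x\<in>C (Suc k). p (\<phi> x) = 0" using S(2) f(1) p(2) by auto
    moreover have "p (\<phi> x) \<noteq> 0" using \<open>x \<in> carrier G\<close> f(2) p(2) by simp
    ultimately show ?thesis using p(1) x(1) by blast
  qed
  then obtain p where p: "\<And>k. p k \<in> poly_funs n" "\<And>k. \<forall>x\<in>C (Suc k). p k (\<phi> x) = 0"
    "\<And>k. \<exists>x\<in>C k. p k (\<phi> x) \<noteq> 0" by metis
  show False
  proof (rule no_strictly_descending_zero_sets[of "\<lambda>k. \<phi> ` C k" n p])
    show "\<phi> ` C k \<subseteq> carrier_vec n" for k
      using bij_betw_imp_surj_on[OF \<phi>] sub[of k] by auto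
    show "\<phi> ` C (Suc k) \<subseteq> \<phi> ` C k" for k using less[of k] by blast
    show "p k \<in> poly_funs n" for k by (rule p(1))
    show "\<forall>v\<in>\<phi> ` C (Suc k). p k v = 0" for k using p(2)[of k] by simp
    show "\<exists>v\<in>\<phi> ` C k. p k v \<noteq> 0" for k using p(3)[of k] by simp
  qed
qed

text \<open>Noetherian induction: a closed set that is not connected splits into two strictly
  smaller closed sets, whose covers are united.\<close>

lemma closedin_zariski_finite_connected_cover:
  assumes "closedin (zariski_topology G) C"
  shows "\<exists>\<K>. finite \<K> \<and> (\<forall>K\<in>\<K>. connectedin (zariski_topology G) K) \<and> C = \<Union>\<K>"
  using assms
proof (induction C rule: wf_induct_rule[OF wf_closedin_zariski])
  case (1 C)
  note IH = 1(1)
  show ?case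
  proof (cases "connectedin (zariski_topology G) C")
    case True
    then show ?thesis by (intro exI[of _ "{C}"]) auto
  next
    case False
    moreover have "C \<subseteq> topspace (zariski_topology G)" by (rule closedin_subset) (rule 1(2))
    ultimately have "\<exists>D E. closedin (zariski_topology G) D \<and> closedin (zariski_topology G) E \<and>
        C \<subseteq> D \<union> E \<and> D \<inter> E \<inter> C = {} \<and> D \<inter> C \<noteq> {} \<and> E \<inter> C \<noteq> {}"
      unfolding connectedin_closedin by blast
    then obtain D E where cl: "closedin (zariski_topology G) D" "closedin (zariski_topology G) E"
      and DE: "C \<subseteq> D \<union> E" "D \<inter> E \<inter> C = {}" "D \<inter> C \<noteq> {}" "E \<inter> C \<noteq> {}"
      by (elim exE conjE)
    have cl': "closedin (zariski_topology G) (D \<inter> C)" "closedin (zariski_topology G) (E \<inter> C)"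
      using cl 1(2) by auto
    have less: "D \<inter> C \<subset> C" "E \<inter> C \<subset> C" using DE by auto
    obtain \<K> where \<K>: "finite \<K>" "\<forall>K\<in>\<K>. connectedin (zariski_topology G) K" "D \<inter> C = \<Union>\<K>"
      using IH[of "D \<inter> C"] cl'(1) less(1) 1(2) by auto
    obtain \<L> where \<L>: "finite \<L>" "\<forall>K\<in>\<L>. connectedin (zariski_topology G) K" "E \<inter> C = \<Union>\<L>"
      using IH[of "E \<inter> C"] cl'(2) less(2) 1(2) by auto
    have "C = (D \<inter> C) \<union> (E \<inter> C)" using DE(1) by blast
    also have "\<dots> = \<Union>(\<K> \<union> \<L>)" unfolding \<K>(3) \<L>(3) by (rule Union_Un_distrib[symmetric])
    finally show ?thesis using \<K>(1,2) \<L>(1,2) by (intro exI[of _ "\<K> \<union> \<L>"]) auto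
  qed
qed

text \<open>A connected set through \<open>x\<close>, translated by \<open>inv x\<close>, lies in
  the identity component. Each piece of a finite connected cover therefore lies in a single coset,
  which any point chosen from the piece recovers.\<close>

lemma finite_rcosets_identity_component: "finite (rcosets (identity_component G))"
proof -
  obtain \<K> where \<K>: "finite \<K>" "\<forall>K\<in>\<K>. connectedin (zariski_topology G) K" "carrier G = \<Union>\<K>"
    using closedin_zariski_finite_connected_cover[of "carrier G"]
      closedin_topspace[of "zariski_topology G"] topspace_zariski by auto
  have "rcosets (identity_component G) \<subseteq> (\<lambda>K. identity_component G #> (SOME x. x \<in> K)) ` \<K>"
  proof
    fix R assume "R \<in> rcosets (identity_component G)"
    then obtain x where x: "x \<in> carrier G" "R = identity_component G #> x"
      by (auto simp: RCOSETS_def)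
    then obtain K where K: "K \<in> \<K>" "x \<in> K" using \<K>(3) by blast
    define y where "y = (SOME x. x \<in> K)"
    have y: "y \<in> K" unfolding y_def using K(2) by (rule someI)
    then have yG: "y \<in> carrier G" using K(1) \<K>(3) by blast
    have "(\<lambda>z. z \<otimes> inv x) ` K \<subseteq> identity_component G"
      using K x(1) \<K>(2)
      by (intro identity_component_maximal connectedin_right_translate)
        (auto intro!: image_eqI[of _ _ x])
    then have "y \<otimes> inv x \<in> identity_component G" using y by blast
    then have "y \<in> identity_component G #> x"
      using subgroup.rcos_module_rev[OF subgroup_identity_component is_group x(1) yG] by blast
    then have "R = identity_component G #> y"
      using repr_independence[OF _ x(1) subgroup_identity_component] x(2) by blast
    then show "R \<in> (\<lambda>K. identity_component G #> (SOME x. x \<in> K)) ` \<K>"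
      using K(1) y_def by blast
  qed
  then show ?thesis by (rule finite_subset) (simp add: \<K>(1))
qed

end

subsection \<open>Normal subgroups of finite index\<close>

text \<open>The group axioms only see three record fields, so they pass from \<open>G Mod H\<close>
  and from \<open>G\<close> restricted to \<open>H\<close> to the records that also carry a
  coordinate ring.\<close>

lemma group_cong:
  fixes G :: "('a, 'b) monoid_scheme" and G' :: "('a, 'c) monoid_scheme"
  assumes "group G" and eq: "carrier G' = carrier G"
    "monoid.mult G' = monoid.mult G" "monoid.one G' = monoid.one G"
  shows "group G'"
proof -
  interpret group G by fact
  show ?thesis
    by (rule groupI) (auto simp: eq m_assoc intro: l_inv_ex)
qed

lemma alg_quotient_simps:
  "carrier (alg_quotient G H) = carrier (G Mod H)"
  "monoid.mult (alg_quotient G H) = monoid.mult (G Mod H)"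
  "monoid.one (alg_quotient G H) = monoid.one (G Mod H)"
  "coord_ring (alg_quotient G H) = {f. (\<lambda>x. f (H #>\<^bsub>G\<^esub> x)) \<in> coord_ring G}"
  by (simp_all add: alg_quotient_def monoid.defs alg_group.defs)

lemma alg_subgroup_simps:
  "carrier (alg_subgroup G H) = H"
  "monoid.mult (alg_subgroup G H) = monoid.mult G"
  "monoid.one (alg_subgroup G H) = monoid.one G"
  "coord_ring (alg_subgroup G H) = {f. \<exists>h\<in>coord_ring G. \<forall>x\<in>H. f x = h x}"
  by (simp_all add: alg_subgroup_def)

context lin_alg_group
begin

lemma group_alg_quotient:
  assumes "H \<lhd> G"
  shows "group (alg_quotient G H)"
  using normal.factorgroup_is_group[OF assms] by (rule group_cong) (simp_all add: alg_quotient_simps)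

lemma group_alg_subgroup:
  assumes "subgroup H G"
  shows "group (alg_subgroup G H)"
  using subgroup.subgroup_is_group[OF assms is_group]
  by (rule group_cong) (simp_all add: alg_subgroup_simps)

lemma rational_rep_alg_subgroup:
  assumes "rational_rep G n \<rho>" "subgroup H G"
  shows "rational_rep (alg_subgroup G H) n \<rho>"
  using assms(1) subgroup.subset[OF assms(2)]
  unfolding rational_rep_def alg_subgroup_simps by (auto simp: subset_iff)

text \<open>
  The points \<open>xs\<close> represent the classes of elements that \<open>H\<close>-invariant regular functions cannot
  tell apart. As there are finitely many classes, Lagrange interpolation makes their
  indicator functions \<open>e\<close> regular. That the classes are the cosets of \<open>H\<close> would need the
  Nullstellensatz, but is irrelevant here.
\<close>

lemma invariant_function_classes:
  assumes H: "H \<lhd> G" and fin: "finite (rcosets H)"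
  obtains m :: nat and xs :: "nat \<Rightarrow> 'g" and idx :: "'g \<Rightarrow> nat" and e :: "nat \<Rightarrow> 'g \<Rightarrow> 'k"
  where "\<And>j. j < m \<Longrightarrow> xs j \<in> carrier G"
    and "\<And>x. x \<in> carrier G \<Longrightarrow> idx x < m"
    and "\<And>j. j < m \<Longrightarrow> idx (xs j) = j"
    and "\<And>g x y. g \<in> carrier G \<Longrightarrow> x \<in> carrier G \<Longrightarrow> y \<in> carrier G \<Longrightarrow> idx x = idx y \<Longrightarrow>
           idx (g \<otimes> x) = idx (g \<otimes> y)"
    and "\<And>h x. h \<in> H \<Longrightarrow> x \<in> carrier G \<Longrightarrow> idx (h \<otimes> x) = idx x"
    and "\<And>b x. b \<in> coord_ring G \<Longrightarrow> \<forall>h\<in>H. \<forall>x\<in>carrier G. b (h \<otimes> x) = b x \<Longrightarrow>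
           x \<in> carrier G \<Longrightarrow> b x = b (xs (idx x))"
    and "\<And>i. i < m \<Longrightarrow> e i \<in> coord_ring G"
    and "\<And>i x. i < m \<Longrightarrow> x \<in> carrier G \<Longrightarrow> e i x = (if i = idx x then 1 else 0)"
proof -
  interpret normal H G by (rule H)
  define B where "B = {b \<in> coord_ring G. \<forall>h\<in>H. \<forall>x\<in>carrier G. b (h \<otimes> x) = b x}"
  define cls where "cls x = {y \<in> carrier G. \<forall>b\<in>B. b y = b x}" for x
  have cls_eq: "cls x = cls y \<longleftrightarrow> (\<forall>b\<in>B. b x = b y)" if "x \<in> carrier G" "y \<in> carrier G" for x y
  proof
    assume "cls x = cls y"
    moreover have "x \<in> cls x" using that by (simp add: cls_def)
    ultimately show "\<forall>b\<in>B. b x = b y" by (simp add: cls_def)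
  qed (auto simp: cls_def)
  \<comment> \<open>By normality \<open>g \<otimes> h\<close> is an element of \<open>H\<close>
    times \<open>g\<close>, so left translation preserves \<open>H\<close>-invariance. This is what
    lets \<open>G\<close> act on the classes.\<close>
  have B_translate: "(\<lambda>x. b (g \<otimes> x)) \<in> B" if b: "b \<in> B" and g: "g \<in> carrier G" for b g
  proof -
    have "b (g \<otimes> (h \<otimes> x)) = b (g \<otimes> x)" if h: "h \<in> H" and x: "x \<in> carrier G" for h x
    proof -
      have h': "h \<in> carrier G" using h by (rule mem_carrier)
      have "g \<otimes> h \<otimes> inv g \<in> H" using g h by (rule inv_op_closed2)
      moreover have "g \<otimes> (h \<otimes> x) = (g \<otimes> h \<otimes> inv g) \<otimes> (g \<otimes> x)"
        using g h' x by (simp add: m_assoc inv_solve_left)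
      ultimately show ?thesis using b g x by (simp add: B_def)
    qed
    then show ?thesis using b g coord_ring_left_translate by (simp add: B_def)
  qed
  have cls_H: "cls (h \<otimes> x) = cls x" if "h \<in> H" "x \<in> carrier G" for h x
    using that by (simp add: cls_eq B_def)
  \<comment> \<open>A class contains the whole coset of each of its points, so there are at most as
    many classes as cosets.\<close>
  have "cls ` carrier G \<subseteq> (\<lambda>K. cls (SOME x. x \<in> K)) ` (rcosets H)"
  proof
    fix c assume "c \<in> cls ` carrier G"
    then obtain x where x: "x \<in> carrier G" "c = cls x" by blast
    have "(SOME y. y \<in> H #> x) \<in> H #> x" using rcos_self[OF x(1) is_subgroup] by (rule someI)
    then obtain h where "h \<in> H" "(SOME y. y \<in> H #> x) = h \<otimes> x" by (auto simp: r_coset_def)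
    then have "c = cls (SOME y. y \<in> H #> x)" using x cls_H by simp
    moreover have "H #> x \<in> rcosets H" using x(1) by (auto simp: RCOSETS_def)
    ultimately show "c \<in> (\<lambda>K. cls (SOME x. x \<in> K)) ` (rcosets H)" by blast
  qed
  then have finC: "finite (cls ` carrier G)" using fin by (rule finite_subset[OF _ finite_imageI])
  define m where "m = card (cls ` carrier G)"
  obtain C where C: "bij_betw C {0..<m} (cls ` carrier G)"
    using ex_bij_betw_nat_finite[OF finC] unfolding m_def by blast
  have "\<exists>x. x \<in> carrier G \<and> cls x = C j" if "j < m" for j
  proof -
    have "C j \<in> cls ` carrier G" using C by (rule bij_betw_apply) (use that in simp)
    then obtain x where "C j = cls x" "x \<in> carrier G" by (rule imageE)
    then show ?thesis by (intro exI[of _ x]) simp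
  qed
  then obtain xs where xs: "\<And>j. j < m \<Longrightarrow> xs j \<in> carrier G" "\<And>j. j < m \<Longrightarrow> cls (xs j) = C j"
    by metis
  define idx where "idx x = the_inv_into {0..<m} C (cls x)" for x
  have inj: "inj_on C {0..<m}" and im: "C ` {0..<m} = cls ` carrier G"
    using C by (auto simp: bij_betw_def)
  have idx_less: "idx x < m" if "x \<in> carrier G" for x
    using the_inv_into_into[OF inj, of "cls x" "{0..<m}"] that im by (simp add: idx_def)
  have C_idx: "C (idx x) = cls x" if "x \<in> carrier G" for x
    unfolding idx_def by (rule f_the_inv_into_f[OF inj]) (use that im in simp)
  have idx_xs: "idx (xs j) = j" if "j < m" for j
    using that xs(2) the_inv_into_f_f[OF inj] by (simp add: idx_def)
  have idx_iff: "idx x = idx y \<longleftrightarrow> (\<forall>b\<in>B. b x = b y)" if "x \<in> carrier G" "y \<in> carrier G" for x y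
  proof -
    have "idx x = idx y \<longleftrightarrow> cls x = cls y"
    proof
      assume "idx x = idx y"
      then show "cls x = cls y" by (simp flip: C_idx[OF that(1)] C_idx[OF that(2)])
    qed (simp add: idx_def)
    then show ?thesis by (simp only: cls_eq[OF that])
  qed
  have B_xs: "b x = b (xs (idx x))" if "b \<in> B" "x \<in> carrier G" for b x
    using idx_iff[of x "xs (idx x)"] idx_xs idx_less xs(1) that by simp
  have "\<exists>b\<in>B. b (xs j) \<noteq> b (xs i)" if "i < m" "j < m" "i \<noteq> j" for i j
    using idx_iff[of "xs j" "xs i"] idx_xs xs(1) that by auto
  then obtain s where s: "\<And>i j. i < m \<Longrightarrow> j < m \<Longrightarrow> i \<noteq> j \<Longrightarrow> s i j \<in> B"
    "\<And>i j. i < m \<Longrightarrow> j < m \<Longrightarrow> i \<noteq> j \<Longrightarrow> s i j (xs j) \<noteq> s i j (xs i)"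
    by metis
  \<comment> \<open>The factor for \<open>j\<close> vanishes on class \<open>j\<close> and equals 1
    on class \<open>i\<close>, since \<open>s i j\<close> separates the two.\<close>
  define e where "e i x = (\<Prod>j\<in>{..<m} - {i}.
      (s i j x + - s i j (xs j)) * inverse (s i j (xs i) - s i j (xs j)))" for i x
  have e_ring: "e i \<in> coord_ring G" if "i < m" for i
    unfolding e_def
    by (intro coord_ring_prod coord_ring_mult coord_ring_add coord_ring_const)
      (use s(1) that in \<open>auto simp: B_def\<close>)
  have e: "e i x = (if i = idx x then 1 else 0)" if i: "i < m" and x: "x \<in> carrier G" for i x
  proof (cases "i = idx x")
    case True
    have "(s i j x + - s i j (xs j)) * inverse (s i j (xs i) - s i j (xs j)) = 1"
      if "j \<in> {..<m} - {i}" for j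
      using B_xs[OF s(1) x, of i j] s(2)[of i j] that i True by auto
    then show ?thesis using True by (simp add: e_def)
  next
    case False
    then have "idx x \<in> {..<m} - {i}" using idx_less[OF x] by simp
    moreover have "s i (idx x) x + - s i (idx x) (xs (idx x)) = 0"
      using B_xs[OF s(1) x, of i "idx x"] False i idx_less[OF x] by simp
    ultimately have "e i x = 0" unfolding e_def by (intro prod_zero) (auto intro!: bexI[of _ "idx x"])
    then show ?thesis using False by simp
  qed
  show thesis
  proof (rule that[of m xs idx e])
    show "idx (g \<otimes> x) = idx (g \<otimes> y)"
      if "g \<in> carrier G" "x \<in> carrier G" "y \<in> carrier G" "idx x = idx y" for g x y
    proof -
      have eq: "\<forall>b\<in>B. b x = b y" using that idx_iff by simp
      have "b (g \<otimes> x) = b (g \<otimes> y)" if "b \<in> B" for b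
        using bspec[OF eq B_translate[OF that \<open>g \<in> carrier G\<close>]] by simp
      then show ?thesis using that idx_iff by simp
    qed
    show "idx (h \<otimes> x) = idx x" if "h \<in> H" "x \<in> carrier G" for h x
      using cls_H[OF that] by (simp add: idx_def)
    show "b x = b (xs (idx x))"
      if "b \<in> coord_ring G" "\<forall>h\<in>H. \<forall>x\<in>carrier G. b (h \<otimes> x) = b x" "x \<in> carrier G" for b x
      using that by (intro B_xs) (auto simp: B_def)
  qed (fact xs(1) idx_less idx_xs e_ring e)+
qed

text \<open>
  The \<open>G\<close>-orbit of an \<open>H\<close>-invariant \<open>f\<close> gives an equivariant polynomial map from \<open>V\<close> to a
  permutation module of \<open>G/H\<close>, along which \<open>G/H\<close>-invariants are pulled back.
\<close>

lemma equivariant_map_to_quotient_module: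
  assumes H: "H \<lhd> G" and fin: "finite (rcosets H)" and rep: "rational_rep G n \<rho>"
    and f: "f \<in> invariants_le (alg_subgroup G H) n \<rho> d" "f (0\<^sub>v n) = 0"
  obtains m \<sigma> w where "0 < m" "rational_rep (alg_quotient G H) m \<sigma>"
    and "\<And>j. j < m \<Longrightarrow> w j \<in> poly_funs_le n d" "\<And>j. j < m \<Longrightarrow> w j (0\<^sub>v n) = 0"
    and "\<And>j v. j < m \<Longrightarrow> v \<in> fixed_points G n \<rho> \<Longrightarrow> w j v = f v"
    and "\<And>g v. g \<in> carrier G \<Longrightarrow> v \<in> carrier_vec n \<Longrightarrow>
      vec m (\<lambda>j. w j (\<rho> g *\<^sub>v v)) = \<sigma> (H #> g) *\<^sub>v vec m (\<lambda>j. w j v)"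
proof -
  interpret normal H G by (rule H)
  obtain m :: nat and xs idx e where
    xs: "\<And>j. j < m \<Longrightarrow> xs j \<in> carrier G" and
    idx_less: "\<And>x. x \<in> carrier G \<Longrightarrow> idx x < m" and
    idx_xs: "\<And>j. j < m \<Longrightarrow> idx (xs j) = j" and
    idx_cong: "\<And>g x y. g \<in> carrier G \<Longrightarrow> x \<in> carrier G \<Longrightarrow> y \<in> carrier G \<Longrightarrow> idx x = idx y \<Longrightarrow>
      idx (g \<otimes> x) = idx (g \<otimes> y)" and
    idx_H: "\<And>h x. h \<in> H \<Longrightarrow> x \<in> carrier G \<Longrightarrow> idx (h \<otimes> x) = idx x" and
    inv_fun: "\<And>b x. b \<in> coord_ring G \<Longrightarrow> \<forall>h\<in>H. \<forall>x\<in>carrier G. b (h \<otimes> x) = b x \<Longrightarrow>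
      x \<in> carrier G \<Longrightarrow> b x = b (xs (idx x))" and
    e_ring: "\<And>i. i < m \<Longrightarrow> e i \<in> coord_ring G" and
    e: "\<And>i x. i < m \<Longrightarrow> x \<in> carrier G \<Longrightarrow> e i x = (if i = idx x then 1 else (0 :: 'k))"
    by (rule invariant_function_classes[OF H fin]) blast
  have idx_xs_idx: "idx (g \<otimes> xs (idx x)) = idx (g \<otimes> x)" if "g \<in> carrier G" "x \<in> carrier G" for g x
    using that by (intro idx_cong) (auto simp: xs idx_less idx_xs)
  \<comment> \<open>The permutation matrix of left translation by \<open>g\<close> on the classes:
    column \<open>j\<close> has its entry 1 in the row of the class of
    \<open>g \<otimes> xs j\<close>.\<close>
  define P :: "'g \<Rightarrow> 'k mat" where
    "P g = mat m m (\<lambda>(i, j). if i = idx (g \<otimes> xs j) then 1 else 0)" for g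
  \<comment> \<open>A representation of the quotient takes cosets as arguments, so a representative
    is chosen; \<open>idx_H\<close> makes the result independent of the choice.\<close>
  define \<sigma> where "\<sigma> K = P (SOME g. g \<in> K)" for K
  have \<sigma>: "\<sigma> (H #> g) = P g" if g: "g \<in> carrier G" for g
  proof -
    have "(SOME y. y \<in> H #> g) \<in> H #> g" using rcos_self[OF g is_subgroup] by (rule someI)
    then obtain h where h: "h \<in> H" "(SOME y. y \<in> H #> g) = h \<otimes> g" by (auto simp: r_coset_def)
    have "idx (h \<otimes> g \<otimes> xs j) = idx (g \<otimes> xs j)" if "j < m" for j
      using that h(1) g xs idx_H[of h "g \<otimes> xs j"] by (simp add: m_assoc mem_carrier)
    then show ?thesis unfolding \<sigma>_def h(2) P_def by (intro cong_mat) auto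
  qed
  have P_one: "P \<one> = 1\<^sub>m m"
    unfolding P_def one_mat_def by (intro cong_mat) (auto simp: xs idx_xs)
  have P_mult: "P (g \<otimes> g') = P g * P g'" if "g \<in> carrier G" "g' \<in> carrier G" for g g'
  proof (rule eq_matI)
    fix i j assume "i < dim_row (P g * P g')" "j < dim_col (P g * P g')"
    then have ij: "i < m" "j < m" by (auto simp: P_def)
    have "(P g * P g') $$ (i, j) =
        (\<Sum>k<m. (if i = idx (g \<otimes> xs k) then 1 else 0) * (if k = idx (g' \<otimes> xs j) then 1 else 0))"
      using ij by (simp add: P_def scalar_prod_def atLeast0LessThan)
    also have "\<dots> = (\<Sum>k<m. if k = idx (g' \<otimes> xs j) then if i = idx (g \<otimes> xs k) then 1 else 0 else 0)"
      by (intro sum.cong) auto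
    also have "\<dots> = (if i = idx (g \<otimes> xs (idx (g' \<otimes> xs j))) then 1 else 0)"
      using idx_less[of "g' \<otimes> xs j"] that xs ij by (simp add: sum.delta)
    also have "idx (g \<otimes> xs (idx (g' \<otimes> xs j))) = idx (g \<otimes> g' \<otimes> xs j)"
      using idx_xs_idx that xs ij by (simp add: m_assoc)
    finally show "P (g \<otimes> g') $$ (i, j) = (P g * P g') $$ (i, j)"
      using ij by (simp add: P_def)
  qed (simp_all add: P_def)
  have rep': "rational_rep (alg_quotient G H) m \<sigma>"
    unfolding rational_rep_def alg_quotient_simps carrier_FactGroup
  proof (intro conjI ballI allI impI)
    fix K assume "K \<in> (#>) H ` carrier G"
    then show "\<sigma> K \<in> carrier_mat m m" by (auto simp: \<sigma> P_def)
  next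
    have "\<one>\<^bsub>G Mod H\<^esub> = H #> \<one>" using subset by (simp add: FactGroup_def coset_mult_one)
    then show "\<sigma> \<one>\<^bsub>G Mod H\<^esub> = 1\<^sub>m m" 
      by (simp only: \<sigma>[OF mem_carrier[OF one_closed]] P_one)
  next
    fix K L assume "K \<in> (#>) H ` carrier G" "L \<in> (#>) H ` carrier G"
    then obtain g g' where g: "g \<in> carrier G" "K = H #> g" "g' \<in> carrier G" "L = H #> g'" by blast
    then have "K \<otimes>\<^bsub>G Mod H\<^esub> L = H #> (g \<otimes> g')" by (simp add: FactGroup_def rcos_sum)
    then show "\<sigma> (K \<otimes>\<^bsub>G Mod H\<^esub> L) = \<sigma> K * \<sigma> L" using g by (simp add: \<sigma> P_mult)
  next
    fix i j assume ij: "i < m" "j < m"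
    \<comment> \<open>As a function of \<open>x\<close> the entry is the indicator
      \<open>e i\<close> evaluated at \<open>x \<otimes> xs j\<close>, hence regular.\<close>
    have "(\<lambda>x. \<sigma> (H #> x) $$ (i, j)) \<in> coord_ring G"
      by (rule coord_ring_cong[OF coord_ring_right_translate[OF e_ring[OF ij(1)] xs[OF ij(2)]]])
        (use ij xs in \<open>simp add: \<sigma> P_def e\<close>)
    then show "(\<lambda>K. \<sigma> K $$ (i, j)) \<in> {f. (\<lambda>x. f (H #> x)) \<in> coord_ring G}" by simp
  qed
  have \<rho>: "\<rho> g \<in> carrier_mat n n" if "g \<in> carrier G" for g
    using rep that by (simp add: rational_rep_def)
  have f_poly: "f \<in> poly_funs_le n d" and fH: "\<And>h v. h \<in> H \<Longrightarrow> v \<in> carrier_vec n \<Longrightarrow> f (\<rho> h *\<^sub>v v) = f v"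
    using f(1) invariants_iff[OF group_alg_subgroup[OF is_subgroup]]
    by (auto simp: invariants_le_def alg_subgroup_simps)
  define w where "w j v = f (\<rho> (inv (xs j)) *\<^sub>v v)" for j v
  \<comment> \<open>For fixed \<open>v\<close> the left-hand side is regular in \<open>x\<close>. By
    normality and the \<open>H\<close>-invariance of \<open>f\<close> it is unchanged when
    \<open>x\<close> is multiplied by \<open>H\<close> from the left, so it depends only on the
    class of \<open>x\<close>.\<close>
  have orbit: "f (\<rho> (inv x) *\<^sub>v v) = w (idx x) v" if v: "v \<in> carrier_vec n" and x: "x \<in> carrier G" for x v
  proof -
    have "(\<lambda>x. f (\<rho> (inv x) *\<^sub>v v)) \<in> coord_ring G"
      using coord_ring_inv[OF coord_ring_orbit_map[OF rep _ v]] f_poly by (auto simp: poly_funs_def)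
    moreover have "f (\<rho> (inv (h \<otimes> x)) *\<^sub>v v) = f (\<rho> (inv x) *\<^sub>v v)" if h: "h \<in> H" and x: "x \<in> carrier G" for h x
    proof -
      have h': "h \<in> carrier G" using h by (rule mem_carrier)
      have hx: "inv x \<otimes> inv h \<otimes> x \<in> H" using x h by (intro inv_op_closed1) auto
      have "inv (h \<otimes> x) = (inv x \<otimes> inv h \<otimes> x) \<otimes> inv x"
        using h' x by (simp add: inv_mult_group m_assoc)
      then have "\<rho> (inv (h \<otimes> x)) *\<^sub>v v = \<rho> (inv x \<otimes> inv h \<otimes> x) *\<^sub>v (\<rho> (inv x) *\<^sub>v v)"
        using rational_rep_mult_vec[OF rep mem_carrier[OF hx] inv_closed[OF x] v] by simp
      then show ?thesis
        using fH[OF hx rational_rep_mult_vec_closed[OF rep inv_closed[OF x] v]] by simp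
    qed
    ultimately show ?thesis unfolding w_def using x by (intro inv_fun) auto
  qed
  show thesis
  proof (rule that[of m \<sigma> w])
    show "0 < m" using idx_less[OF mem_carrier[OF one_closed]] by simp
    show "w j \<in> poly_funs_le n d" if "j < m" for j
      unfolding w_def using that xs by (intro poly_funs_le_linear_subst[OF f_poly] \<rho>) simp
    show "w j (0\<^sub>v n) = 0" if "j < m" for j
      using that xs f(2) rational_rep_mult_zero_vec[OF rep] by (simp add: w_def)
    show "w j v = f v" if "j < m" "v \<in> fixed_points G n \<rho>" for j v
      using that xs by (simp add: w_def fixed_points_def)
    show "vec m (\<lambda>j. w j (\<rho> g *\<^sub>v v)) = \<sigma> (H #> g) *\<^sub>v vec m (\<lambda>j. w j v)"
      if g: "g \<in> carrier G" and v: "v \<in> carrier_vec n" for g v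
    proof (rule eq_vecI)
      fix i assume "i < dim_vec (\<sigma> (H #> g) *\<^sub>v vec m (\<lambda>j. w j v))"
      then have i: "i < m" using g by (simp add: \<sigma> P_def)
      \<comment> \<open>Translation by \<open>inv g\<close> inverts the permutation given by
        \<open>g\<close>, which singles out the only column with a nonzero entry in row
        \<open>i\<close>.\<close>
      have iff: "i = idx (g \<otimes> xs j) \<longleftrightarrow> j = idx (inv g \<otimes> xs i)" if j: "j < m" for j
      proof
        assume "i = idx (g \<otimes> xs j)"
        then have "idx (inv g \<otimes> xs i) = idx (inv g \<otimes> (g \<otimes> xs j))"
          using g xs[OF j] by (simp add: idx_xs_idx)
        then show "j = idx (inv g \<otimes> xs i)" using g xs j idx_xs by (simp flip: m_assoc)
      next
        assume "j = idx (inv g \<otimes> xs i)"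
        then have "idx (g \<otimes> xs j) = idx (g \<otimes> (inv g \<otimes> xs i))"
          using g xs[OF i] by (simp add: idx_xs_idx)
        then show "i = idx (g \<otimes> xs j)" using g xs i idx_xs by (simp flip: m_assoc)
      qed
      have "(\<sigma> (H #> g) *\<^sub>v vec m (\<lambda>j. w j v)) $ i =
          (\<Sum>j<m. (if i = idx (g \<otimes> xs j) then 1 else 0) * w j v)"
        using i g by (simp add: \<sigma> P_def scalar_prod_def atLeast0LessThan)
      also have "\<dots> = (\<Sum>j<m. if j = idx (inv g \<otimes> xs i) then w j v else 0)"
        by (intro sum.cong) (auto simp: iff)
      also have "\<dots> = w (idx (inv g \<otimes> xs i)) v"
        using idx_less[of "inv g \<otimes> xs i"] g xs[OF i] by (simp add: sum.delta)
      also have "\<dots> = f (\<rho> (inv (inv g \<otimes> xs i)) *\<^sub>v v)"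
        using orbit[OF v, of "inv g \<otimes> xs i"] g xs[OF i] by simp
      also have "\<dots> = w i (\<rho> g *\<^sub>v v)"
        using g xs[OF i] v rational_rep_mult_vec[OF rep _ g v, of "inv (xs i)"]
        by (simp add: w_def inv_mult_group)
      finally show "vec m (\<lambda>j. w j (\<rho> g *\<^sub>v v)) $ i = (\<sigma> (H #> g) *\<^sub>v vec m (\<lambda>j. w j v)) $ i"
        using i by simp
    qed (use g in \<open>simp add: \<sigma> P_def\<close>)
  qed (rule rep')
qed

lemma finite_carrier_alg_quotient:
  "finite (rcosets H) \<Longrightarrow> finite (carrier (alg_quotient G H))"
  by (simp add: alg_quotient_simps FactGroup_def)

lemma delta_set_finite_index:
  assumes H: "H \<lhd> G" and fin: "finite (rcosets H)"
    and e: "delta (alg_quotient G H) \<le> enat e" and d: "delta (alg_subgroup G H) \<le> enat d"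
    and rep: "rational_rep G n \<rho>"
  shows "delta_set G n \<rho> (invariants_le G n \<rho> (e * d))"
  unfolding delta_set_def
proof (intro conjI ballI)
  interpret normal H G by (rule H)
  let ?Q = "alg_quotient G H" and ?S = "alg_subgroup G H"
  have Q: "group ?Q" by (rule group_alg_quotient[OF H])
  have S: "group ?S" by (rule group_alg_subgroup[OF is_subgroup])
  fix v assume v: "v \<in> fixed_points G n \<rho> - nullcone G n \<rho>"
  then have vc: "v \<in> carrier_vec n" by (simp add: fixed_points_def)
  have "v \<in> fixed_points ?S n \<rho>"
    using v subset by (auto simp: fixed_points_def alg_subgroup_simps)
  \<comment> \<open>Every \<open>G\<close>-invariant is an \<open>H\<close>-invariant, so the
    nullcone of \<open>H\<close> is contained in that of \<open>G\<close>.\<close>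
  moreover have "v \<notin> nullcone ?S n \<rho>"
  proof -
    have "invariants G n \<rho> \<subseteq> invariants ?S n \<rho>"
      using subset by (auto simp: invariants_iff[OF S] invariants_iff[OF is_group] alg_subgroup_simps)
    then show ?thesis using v by (auto simp: nullcone_def zero_const_def)
  qed
  moreover have "delta_set ?S n \<rho> (invariants_le ?S n \<rho> d)"
    using d rational_rep_alg_subgroup[OF rep is_subgroup] delta_le_iff by blast
  ultimately obtain f where f: "f \<in> invariants_le ?S n \<rho> d" "f (0\<^sub>v n) = 0" "f v \<noteq> 0"
    by (auto simp: delta_set_def zero_const_def)
  obtain m \<sigma> w where m: "0 < m" and rep': "rational_rep ?Q m \<sigma>" and
    w: "\<And>j. j < m \<Longrightarrow> w j \<in> poly_funs_le n d" "\<And>j. j < m \<Longrightarrow> w j (0\<^sub>v n) = 0"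
      "\<And>j v. j < m \<Longrightarrow> v \<in> fixed_points G n \<rho> \<Longrightarrow> w j v = f v" and
    equi: "\<And>g v. g \<in> carrier G \<Longrightarrow> v \<in> carrier_vec n \<Longrightarrow>
      vec m (\<lambda>j. w j (\<rho> g *\<^sub>v v)) = \<sigma> (H #> g) *\<^sub>v vec m (\<lambda>j. w j v)"
    by (rule equivariant_map_to_quotient_module[OF H fin rep f(1,2)]) blast
  define W where "W u = vec m (\<lambda>j. w j u)" for u
  have W_fixed: "W v \<in> fixed_points ?Q m \<sigma>"
  proof -
    have "\<sigma> (H #> g) *\<^sub>v W v = W v" if "g \<in> carrier G" for g
      using equi[OF that vc] v that by (simp add: W_def fixed_points_def)
    then show ?thesis
      by (auto simp: fixed_points_def alg_quotient_simps carrier_FactGroup W_def)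
  qed
  \<comment> \<open>All coordinates of \<open>W v\<close> equal \<open>f v\<close>, and
    \<open>0 < m\<close> guarantees that there is one.\<close>
  have "W v $ 0 \<noteq> 0" using w(3)[OF m, of v] m v f(3) by (simp add: W_def)
  then have "W v \<noteq> 0\<^sub>v m" using m by auto
  then have "W v \<notin> nullcone ?Q m \<sigma>"
    using finite_group_nullcone[OF Q finite_carrier_alg_quotient[OF fin] rep' W_fixed] by blast
  moreover have "delta_set ?Q m \<sigma> (invariants_le ?Q m \<sigma> e)"
    using e rep' delta_le_iff by blast
  ultimately obtain F where F: "F \<in> invariants_le ?Q m \<sigma> e" "F (0\<^sub>v m) = 0" "F (W v) \<noteq> 0"
    using W_fixed by (auto simp: delta_set_def zero_const_def)
  have F_poly: "F \<in> poly_funs_le m e"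
    and F_inv: "\<And>g u. g \<in> carrier G \<Longrightarrow> u \<in> carrier_vec m \<Longrightarrow> F (\<sigma> (H #> g) *\<^sub>v u) = F u"
    using F(1) by (auto simp: invariants_le_def invariants_iff[OF Q] alg_quotient_simps carrier_FactGroup)
  have FW: "(\<lambda>u. F (W u)) \<in> poly_funs_le n (e * d)"
    unfolding W_def by (rule poly_funs_le_compose[OF F_poly w(1)])
  have "F (W (\<rho> g *\<^sub>v u)) = F (W u)" if "g \<in> carrier G" "u \<in> carrier_vec n" for g u
    using equi[OF that] F_inv[OF that(1), of "W u"] by (simp add: W_def)
  then have "(\<lambda>u. F (W u)) \<in> invariants_le G n \<rho> (e * d)"
    using FW by (auto simp: invariants_le_def invariants_iff[OF is_group] poly_funs_def)
  moreover have "W (0\<^sub>v n) = 0\<^sub>v m" by (auto simp: W_def w(2))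
  ultimately have "(\<lambda>u. F (W u)) \<in> zero_const n (invariants_le G n \<rho> (e * d))"
    using F(2) by (simp add: zero_const_def)
  then show "\<exists>f\<in>zero_const n (invariants_le G n \<rho> (e * d)). f v \<noteq> 0"
    using F(3) by (intro bexI[of _ "\<lambda>u. F (W u)"])
qed (simp add: invariants_le_def)

text \<open>The identity component enters only through normality and finite index, so the estimate
  is proved at this level of generality.\<close>

theorem delta_finite_index:
  assumes H: "H \<lhd> G" and fin: "finite (rcosets H)"
  shows "delta G \<le> delta (alg_quotient G H) * delta (alg_subgroup G H)"
    and "delta (alg_subgroup G H) < \<infinity> \<Longrightarrow> delta G < \<infinity>"
proof -
  have "delta (alg_quotient G H) \<le> enat (card (carrier (alg_quotient G H)))"
    using delta_finite_group_le[OF group_alg_quotient[OF H] finite_carrier_alg_quotient[OF fin]] .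
  then obtain e where e: "delta (alg_quotient G H) = enat e"
    using enat_ile by blast
  have "delta (alg_quotient G H) \<noteq> 0"
    by (rule delta_pos) (simp add: alg_quotient_simps coord_ring_const)
  then have "e \<noteq> 0" using e by (simp add: zero_enat_def)
  have fin_case: "delta G \<le> enat (e * d)" if "delta (alg_subgroup G H) = enat d" for d
    unfolding delta_le_iff
    by (intro allI impI delta_set_finite_index[OF H fin]) (simp_all add: e that)
  \<comment> \<open>If the factor of \<open>H\<close> is infinite, then \<open>e \<noteq> 0\<close>
    makes the right-hand side infinite.\<close>
  show "delta G \<le> delta (alg_quotient G H) * delta (alg_subgroup G H)"
    using fin_case e \<open>e \<noteq> 0\<close> by (cases "delta (alg_subgroup G H)") auto
  show "delta G < \<infinity>" if "delta (alg_subgroup G H) < \<infinity>"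
    using fin_case that by (cases "delta (alg_subgroup G H)") (auto dest: enat_ile)
qed

end

theorem corollary2p4:
  fixes G :: "('g, 'k::alg_closed_field) alg_group"
  assumes "linear_algebraic_group G"
  shows "delta G \<le> delta (alg_quotient G (identity_component G))
                     * delta (alg_subgroup G (identity_component G))
         \<and> (delta (alg_subgroup G (identity_component G)) < \<infinity> \<longrightarrow> delta G < \<infinity>)"
proof -
  interpret group G using assms by (simp add: linear_algebraic_group_def)
  interpret lin_alg_group G by unfold_locales (rule assms)
  show ?thesis
    using delta_finite_index[OF normal_identity_component finite_rcosets_identity_component]
    by blast
qed

end
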